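(* Let $H=\mathrm{Homeo}_+([0,1])$ be the group of order-preserving homeomorphisms of $[0,1]$. Then every two-dimensional topological similarity class in $H$ is meager in $H\times H$.
   Context: $H$ carries the topology with basic open sets $U(f;a_1,\dots,a_n;\varepsilon)=\{g\in H: |g(a_i)-f(a_i)|<\varepsilon \text{ for } i=1,\dots,n\}$, for $f\in H$, $a_1,\dots,a_n\in[0,1]$, $\varepsilon>0$; this makes $H$ a Polish group. For a topological group $K$, a pair $(g_1,g_2)\in K^2$ is topologically similar to $(f_1,f_2)\in K^2$ if the map $g_i\mapsto f_i$ ($i=1,2$) extends to a group isomorphism $\langle g_1,g_2\rangle\to\langle f_1,f_2\rangle$ that is a homeomorphism with respect to the subspace topologies. Its equivalence classes are the two-dimensional topological similarity classes. *)

theory Defs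
  imports "HOL-Analysis.Analysis" "HOL-Algebra.Generated_Groups"
begin

text \<open>H = Homeo_+([0,1]): order-preserving homeomorphisms of [0,1], represented as
  functions on the reals that are the identity outside [0,1] (so that function
  equality and composition give the group structure).\<close>
definition Homeo_plus :: "(real \<Rightarrow> real) set" where
  "Homeo_plus = {f. (\<exists>g. homeomorphism {0..1} {0..1} f g) \<and> mono_on {0..1} f
                    \<and> (\<forall>x. x \<notin> {0..1} \<longrightarrow> f x = x)}"

definition H_group :: "(real \<Rightarrow> real) monoid" where
  "H_group = \<lparr>carrier = Homeo_plus, mult = (\<lambda>f g. f \<circ> g), one = id\<rparr>"

definition basic_open :: "(real \<Rightarrow> real) \<Rightarrow> real list \<Rightarrow> real \<Rightarrow> (real \<Rightarrow> real) set" where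
  "basic_open f as \<epsilon> = {g \<in> Homeo_plus. \<forall>a\<in>set as. \<bar>g a - f a\<bar> < \<epsilon>}"

definition H_top :: "(real \<Rightarrow> real) topology" where
  "H_top = topology_generated_by
     {basic_open f as \<epsilon> | f as \<epsilon>. f \<in> Homeo_plus \<and> set as \<subseteq> {0..1} \<and> \<epsilon> > 0}"

definition top_similar ::
  "('a, 'b) monoid_scheme \<Rightarrow> 'a topology \<Rightarrow> 'a \<times> 'a \<Rightarrow> 'a \<times> 'a \<Rightarrow> bool" where
  "top_similar G T p q \<longleftrightarrow>
     (\<exists>\<phi>. \<phi> \<in> iso (subgroup_generated G {fst p, snd p}) (subgroup_generated G {fst q, snd q})
        \<and> \<phi> (fst p) = fst q \<and> \<phi> (snd p) = snd q
        \<and> homeomorphic_map (subtopology T (carrier (subgroup_generated G {fst p, snd p})))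
                            (subtopology T (carrier (subgroup_generated G {fst q, snd q}))) \<phi>)"

definition nowhere_dense_in :: "'a topology \<Rightarrow> 'a set \<Rightarrow> bool" where
  "nowhere_dense_in Tp S \<longleftrightarrow> S \<subseteq> topspace Tp \<and> Tp interior_of (Tp closure_of S) = {}"

definition meager_in :: "'a topology \<Rightarrow> 'a set \<Rightarrow> bool" where
  "meager_in Tp S \<longleftrightarrow> (\<exists>\<F>. countable \<F> \<and> (\<forall>N\<in>\<F>. nowhere_dense_in Tp N) \<and> S \<subseteq> \<Union>\<F>)"

end

theory Submission
  imports Defs
begin

text \<open>
  Words in two letters are evaluated at pairs \<open>p\<close> of homeomorphisms. Topological similarity preserves
  both the statement that no nontrivial word is close to the identity and the statement that a
  given sequence of words tends to the identity; we use whichever applies to \<open>(f1, f2)\<close>.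

  The main observation is that pairs without common fixed points in \<open>(0,1)\<close> are dense, and that for
  such a pair every point can be moved arbitrarily close to \<open>0\<close> by some word, because the infimum of
  an orbit is a common fixed point.

  If some neighbourhood of \<open>1\<close> contains no \<open>w(f1, f2)\<close> with \<open>w\<close> reduced and nonempty, the class is covered by the
  sets of pairs with the same property for a fixed basic neighbourhood. Such a set is nowhere dense:
  choose \<open>g\<close> to be the identity near \<open>0\<close> and conjugate it by a word that pushes a given finite set
  into the region where \<open>g\<close> is trivial.

  Otherwise, conjugation yields reduced words \<open>W j\<close> tending to \<open>1\<close> at \<open>(f1, f2)\<close>, where \<open>W j\<close> contains all
  reduced words of length at most \<open>j\<close>. The pairs with \<open>W j\<close> close to \<open>1\<close> for all \<open>j \<ge> N\<close> form a nowhere dense set: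
  a basic open set restricts a pair at finitely many points only, lying in some \<open>[m, M]\<close>. By universality of \<open>W j\<close>
  the trajectory of \<open>1/2\<close> leaves \<open>[m, M]\<close> for large \<open>j\<close>, and from then on it may be prescribed to run
  monotonically towards an endpoint, since \<open>W j\<close> is reduced.
\<close>

section \<open>The group of order-preserving homeomorphisms\<close>

text \<open>Continuity comes for free: a monotone surjection of the line is continuous, and so is
  its inverse. Later constructions therefore only check strict monotonicity and
  surjectivity.\<close>

lemma Homeo_plus_iff:
  "f \<in> Homeo_plus \<longleftrightarrow> strict_mono f \<and> surj f \<and> (\<forall>x. x \<notin> {0..1} \<longrightarrow> f x = x)"
proof
  assume "f \<in> Homeo_plus"
  then obtain g where g: "homeomorphism {0..1} {0..1} f g"
    and mono: "mono_on {0..1} f" and out: "\<And>x. x \<notin> {0..1} \<Longrightarrow> f x = x"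
    by (auto simp: Homeo_plus_def)
  have inj: "inj_on f {0..1}"
    using g by (metis homeomorphism_apply1 inj_on_inverseI)
  have img: "f ` {0..1} = {0..1}"
    using g by (simp add: homeomorphism_def)
  have into: "f x \<in> {0..1}" if "x \<in> {0..1}" for x
    using img that by blast
  have "strict_mono f"
  proof (rule strict_monoI)
    fix x y :: real assume "x < y"
    show "f x < f y"
    proof (cases "x \<in> {0..1} \<and> y \<in> {0..1}")
      case True
      then have "f x \<le> f y" "f x \<noteq> f y"
        using mono_onD[OF mono, of x y] inj_onD[OF inj, of x y] \<open>x < y\<close> by auto
      then show ?thesis by simp
    next
      case False
      then show ?thesis
        using \<open>x < y\<close> into[of x] into[of y] out[of x] out[of y] by fastforce
    qed
  qed
  moreover have "y \<in> range f" for y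
  proof (cases "y \<in> {0..1}")
    case True
    then have "y \<in> f ` {0..1}"
      using img by simp
    then show ?thesis by blast
  next
    case False
    then have "y = f y"
      using out by simp
    then show ?thesis by (rule range_eqI)
  qed
  ultimately show "strict_mono f \<and> surj f \<and> (\<forall>x. x \<notin> {0..1} \<longrightarrow> f x = x)"
    using out by blast
next
  assume "strict_mono f \<and> surj f \<and> (\<forall>x. x \<notin> {0..1} \<longrightarrow> f x = x)"
  then have sm: "strict_mono f" and surj: "surj f" and out: "\<And>x. x \<notin> {0..1} \<Longrightarrow> f x = x"
    by auto
  define g where "g = inv_into UNIV f"
  have fg: "f (g x) = x" for x
    using surj by (simp add: g_def surj_f_inv_f)
  have gf: "g (f x) = x" for x
    using sm by (simp add: g_def strict_mono_imp_inj_on)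
  have g_mono: "g x \<le> g y" if "x \<le> y" for x y
    using that sm fg by (metis strict_mono_less_eq)
  have "continuous_on UNIV f"
    using surj sm by (intro continuous_onI_mono) (auto simp: strict_mono_less_eq)
  moreover have "range g = UNIV"
    using gf by (metis surj_def)
  then have "continuous_on UNIV g"
    using g_mono by (intro continuous_onI_mono) auto
  moreover have into: "f x \<in> {0..1}" if "x \<in> {0..1}" for x
    using that out gf by metis
  moreover have into': "g x \<in> {0..1}" if "x \<in> {0..1}" for x
    using that out fg by metis
  ultimately have "homeomorphism {0..1} {0..1} f g"
    by (intro homeomorphismI) (auto simp: fg gf image_subset_iff intro: continuous_on_subset)
  moreover have "mono_on {0..1} f"
    using sm by (simp add: mono_on_def strict_mono_less_eq)
  ultimately show "f \<in> Homeo_plus"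
    using out by (auto simp: Homeo_plus_def)
qed

lemma Homeo_plus_less_iff: "f \<in> Homeo_plus \<Longrightarrow> f x < f y \<longleftrightarrow> x < y"
  by (simp add: Homeo_plus_iff strict_mono_less)

lemma Homeo_plus_eq_iff: "f \<in> Homeo_plus \<Longrightarrow> f x = f y \<longleftrightarrow> x = y"
  by (simp add: Homeo_plus_iff strict_mono_eq)

lemma Homeo_plus_outside: "f \<in> Homeo_plus \<Longrightarrow> x \<notin> {0..1} \<Longrightarrow> f x = x"
  by (simp add: Homeo_plus_iff)

lemma Homeo_plus_inverse:
  assumes "f \<in> Homeo_plus"
  shows "f (inv_into UNIV f x) = x" "inv_into UNIV f (f x) = x"
  using assms by (auto simp: Homeo_plus_iff surj_f_inv_f strict_mono_imp_inj_on)

lemma id_in_Homeo_plus: "id \<in> Homeo_plus"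
  by (auto simp: Homeo_plus_iff strict_mono_def)

lemma Homeo_plus_comp: "f \<in> Homeo_plus \<Longrightarrow> g \<in> Homeo_plus \<Longrightarrow> f \<circ> g \<in> Homeo_plus"
  using comp_surj[of g f] by (auto simp: Homeo_plus_iff strict_mono_def comp_def)

lemma Homeo_plus_inv:
  assumes "f \<in> Homeo_plus"
  shows "inv_into UNIV f \<in> Homeo_plus"
  unfolding Homeo_plus_iff
proof (intro conjI allI impI)
  show "strict_mono (inv_into UNIV f)"
  proof (rule strict_monoI)
    fix x y :: real assume "x < y"
    then have "f (inv_into UNIV f x) < f (inv_into UNIV f y)"
      by (simp only: Homeo_plus_inverse(1)[OF assms])
    then show "inv_into UNIV f x < inv_into UNIV f y"
      by (simp only: Homeo_plus_less_iff[OF assms])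
  qed
  show "surj (inv_into UNIV f)"
    by (metis assms Homeo_plus_inverse(2) surj_def)
  show "inv_into UNIV f x = x" if "x \<notin> {0..1}" for x
    by (metis assms that Homeo_plus_inverse(2) Homeo_plus_outside)
qed

lemma Homeo_plus_in_01:
  assumes "f \<in> Homeo_plus"
  shows "f x \<in> {0..1} \<longleftrightarrow> x \<in> {0..1}"
  by (metis assms Homeo_plus_eq_iff Homeo_plus_outside)

lemma Homeo_plus_ends:
  assumes "f \<in> Homeo_plus"
  shows "f 0 = 0" "f 1 = 1"
proof -
  have "inv_into UNIV f x \<in> {0..1}" if "x \<in> {0..1}" for x
    using that Homeo_plus_in_01[OF Homeo_plus_inv[OF assms]] by blast
  from this[of 0] this[of 1] have "f 0 \<le> 0" "1 \<le> f 1"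
    using Homeo_plus_less_iff[OF assms] Homeo_plus_inverse(1)[OF assms]
    by (metis atLeastAtMost_iff linorder_not_less order_refl zero_le_one)+
  then show "f 0 = 0" "f 1 = 1"
    using Homeo_plus_in_01[OF assms, of 0] Homeo_plus_in_01[OF assms, of 1] by auto
qed

lemma Homeo_plus_interior:
  assumes "f \<in> Homeo_plus"
  shows "f x \<in> {0<..<1} \<longleftrightarrow> x \<in> {0<..<1}"
  using Homeo_plus_less_iff[OF assms, of 0 x] Homeo_plus_less_iff[OF assms, of x 1]
  by (simp add: Homeo_plus_ends[OF assms])

lemma group_H_group: "group H_group"
proof (rule groupI)
  fix f assume "f \<in> carrier H_group"
  then show "\<exists>g\<in>carrier H_group. g \<otimes>\<^bsub>H_group\<^esub> f = \<one>\<^bsub>H_group\<^esub>"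
    using Homeo_plus_inv Homeo_plus_inverse(2)
    by (intro bexI[of _ "inv_into UNIV f"]) (auto simp: H_group_def fun_eq_iff)
qed (auto simp: H_group_def id_in_Homeo_plus Homeo_plus_comp comp_assoc)

lemma inv_H_group:
  assumes "f \<in> Homeo_plus"
  shows "inv\<^bsub>H_group\<^esub> f = inv_into UNIV f"
  by (rule group.inv_equality[OF group_H_group])
    (use assms Homeo_plus_inv Homeo_plus_inverse(2) in \<open>auto simp: H_group_def fun_eq_iff\<close>)

section \<open>Words\<close>

text \<open>A letter \<open>(b, e)\<close> is the first (\<open>b\<close>) or second (\<open>\<not> b\<close>) generator, inverted unless \<open>e\<close>. The head of a word
  acts first.\<close>

fun letter_map :: "(real \<Rightarrow> real) \<times> (real \<Rightarrow> real) \<Rightarrow> bool \<times> bool \<Rightarrow> real \<Rightarrow> real" where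
  "letter_map p (b, e) =
     (let f = if b then fst p else snd p in if e then f else inv_into UNIV f)"

primrec word_map ::
    "(real \<Rightarrow> real) \<times> (real \<Rightarrow> real) \<Rightarrow> (bool \<times> bool) list \<Rightarrow> real \<Rightarrow> real" where
  "word_map p [] = id"
| "word_map p (s # w) = word_map p w \<circ> letter_map p s"

definition letter_inv :: "bool \<times> bool \<Rightarrow> bool \<times> bool" where
  "letter_inv s = (fst s, \<not> snd s)"

definition word_inv :: "(bool \<times> bool) list \<Rightarrow> (bool \<times> bool) list" where
  "word_inv w = rev (map letter_inv w)"

definition reduced_word :: "(bool \<times> bool) list \<Rightarrow> bool" where
  "reduced_word = successively (\<lambda>s t. t \<noteq> letter_inv s)"

text \<open>Only the first generator is counted: the word in question will be a conjugate of that
  generator, with sum 1.\<close>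

definition exponent_sum :: "(bool \<times> bool) list \<Rightarrow> int" where
  "exponent_sum w = (\<Sum>s\<leftarrow>w. if fst s then (if snd s then 1 else - 1) else 0)"

lemma letter_inv_inv [simp]: "letter_inv (letter_inv s) = s"
  by (simp add: letter_inv_def)

lemma letter_inv_eq_iff [simp]: "letter_inv s = letter_inv t \<longleftrightarrow> s = t"
  by (metis letter_inv_inv)

lemma letter_map_in_Homeo_plus:
  "p \<in> Homeo_plus \<times> Homeo_plus \<Longrightarrow> letter_map p s \<in> Homeo_plus"
  by (cases p; cases s) (auto simp: Let_def Homeo_plus_inv)

lemma word_map_in_Homeo_plus:
  "p \<in> Homeo_plus \<times> Homeo_plus \<Longrightarrow> word_map p w \<in> Homeo_plus"
  by (induction w) (auto simp: id_in_Homeo_plus intro!: Homeo_plus_comp letter_map_in_Homeo_plus)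

lemma word_map_append: "word_map p (u @ v) = word_map p v \<circ> word_map p u"
  by (induction u) (auto simp: fun_eq_iff)

lemma letter_map_letter_inv:
  "p \<in> Homeo_plus \<times> Homeo_plus \<Longrightarrow> letter_map p (letter_inv s) (letter_map p s x) = x"
  by (cases p; cases s) (auto simp: Let_def letter_inv_def Homeo_plus_inverse)

lemma word_map_word_inv:
  "p \<in> Homeo_plus \<times> Homeo_plus \<Longrightarrow> word_map p (word_inv w) (word_map p w x) = x"
  by (induction w arbitrary: x)
    (auto simp: word_inv_def word_map_append letter_map_letter_inv)

lemma reduced_word_word_inv [simp]: "reduced_word (word_inv w) \<longleftrightarrow> reduced_word w"
  unfolding reduced_word_def word_inv_def successively_rev successively_map letter_inv_inv
  by (intro arg_cong2[where f = successively] ext) auto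

lemma reduced_word_Cons: "reduced_word (s # w) \<longleftrightarrow> w = [] \<or> hd w \<noteq> letter_inv s \<and> reduced_word w"
  by (simp add: reduced_word_def successively_Cons)

lemma reduced_word_append:
  "reduced_word (u @ v) \<longleftrightarrow>
     reduced_word u \<and> reduced_word v \<and> (u = [] \<or> v = [] \<or> hd v \<noteq> letter_inv (last u))"
  by (simp add: reduced_word_def successively_append_iff)

lemma reduced_word_nth:
  assumes "reduced_word w" "Suc i < length w"
  shows "w ! Suc i \<noteq> letter_inv (w ! i)"
  using assms
proof (induction w arbitrary: i)
  case (Cons s w)
  then show ?case
    by (cases i) (auto simp: reduced_word_Cons hd_conv_nth)
qed simp

text \<open>The exponent sum serves to certify that a reduced form is nonempty.\<close>

lemma exists_reduced_word:
  "\<exists>v. reduced_word v \<and> exponent_sum v = exponent_sum w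
     \<and> (\<forall>p \<in> Homeo_plus \<times> Homeo_plus. word_map p v = word_map p w)"
proof (induction w)
  case Nil
  then show ?case
    by (intro exI[of _ "[]"]) (auto simp: reduced_word_def)
next
  case (Cons s w)
  then obtain v where v: "reduced_word v" "exponent_sum v = exponent_sum w"
    "\<And>p. p \<in> Homeo_plus \<times> Homeo_plus \<Longrightarrow> word_map p v = word_map p w"
    by blast
  show ?case
  proof (cases "v \<noteq> [] \<and> hd v = letter_inv s")
    case False
    then show ?thesis
      using v by (intro exI[of _ "s # v"]) (auto simp: reduced_word_Cons exponent_sum_def)
  next
    case True
    then obtain v' where v': "v = letter_inv s # v'"
      by (metis list.exhaust_sel)
    show ?thesis
    proof (intro exI[of _ v'] conjI ballI)
      show "reduced_word v'"
        using v(1) by (auto simp: v' reduced_word_def successively_Cons)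
      show "exponent_sum v' = exponent_sum (s # w)"
        using v(2) by (auto simp: v' exponent_sum_def letter_inv_def split: if_splits)
      fix p :: "(real \<Rightarrow> real) \<times> (real \<Rightarrow> real)"
      assume p: "p \<in> Homeo_plus \<times> Homeo_plus"
      show "word_map p v' = word_map p (s # w)"
        using v(3)[OF p, symmetric] by (auto simp: v' fun_eq_iff letter_map_letter_inv[OF p])
    qed
  qed
qed

lemma exists_letter_avoiding:
  obtains l :: "bool \<times> bool" where "l \<noteq> a" "l \<noteq> b" "l \<noteq> c"
proof -
  have "card {a, b, c} \<le> 3"
    by (simp add: card_insert_if)
  moreover have "card (UNIV :: (bool \<times> bool) set) = 4"
    by (simp add: card_cartesian_product flip: UNIV_Times_UNIV)
  ultimately have "{a, b, c} \<noteq> UNIV"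
    by auto
  then show ?thesis
    using that by auto
qed

text \<open>The members of \<open>Q\<close> are appended one after another, each preceded by a
  separating letter that cancels neither with what comes before nor with what follows. With four
  letters available, such a letter always exists.\<close>

lemma exists_reduced_superword:
  assumes "finite Q" "\<And>q. q \<in> Q \<Longrightarrow> reduced_word q"
  shows "\<exists>u. reduced_word u \<and> (\<forall>q\<in>Q. \<exists>y z. u = y @ q @ z)"
  using assms
proof (induction Q rule: finite_induct)
  case empty
  then show ?case
    by (intro exI[of _ "[]"]) (auto simp: reduced_word_def)
next
  case (insert q Q)
  then obtain u where u: "reduced_word u" "\<And>q. q \<in> Q \<Longrightarrow> \<exists>y z. u = y @ q @ z"
    by blast
  obtain l where "l \<noteq> letter_inv (last u)" "l \<noteq> letter_inv (hd q)"
    using exists_letter_avoiding[of "letter_inv (last u)" "letter_inv (hd q)"] by blast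
  then have "reduced_word (u @ l # q)"
    using u(1) insert.prems[of q] by (auto simp: reduced_word_append reduced_word_Cons)
  moreover have "\<exists>y z. u @ l # q = y @ r @ z" if "r \<in> insert q Q" for r
  proof (cases "r = q")
    case True
    then show ?thesis
      by (intro exI[of _ "u @ [l]"] exI[of _ "[]"]) simp
  next
    case False
    then show ?thesis
      using that u(2)[of r] by fastforce
  qed
  ultimately show ?case
    by blast
qed

section \<open>Topology\<close>

lemma topspace_H_top [simp]: "topspace H_top = Homeo_plus"
proof -
  have "\<exists>B. (\<exists>f as \<epsilon>. B = basic_open f as \<epsilon> \<and> f \<in> Homeo_plus \<and> set as \<subseteq> {0..1} \<and> 0 < \<epsilon>) \<and> f \<in> B"
    if "f \<in> Homeo_plus" for f
    using that by (intro exI[of _ "basic_open f [] 1"]) (auto simp: basic_open_def intro!: exI[of _ "[]"] exI[of _ "1::real"])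
  then show ?thesis
    unfolding H_top_def topology_generated_by_topspace by (auto simp: basic_open_def)
qed

text \<open>Subbasic sets may be centred elsewhere; recentring them at the given \<open>f\<close>
  allows perturbations of \<open>f\<close> that are controlled at finitely many points only.\<close>

lemma openin_H_top_nbhd:
  assumes "openin H_top T" "f \<in> T"
  shows "\<exists>A \<epsilon>. finite A \<and> A \<subseteq> {0..1} \<and> 0 < \<epsilon> \<and> {g \<in> Homeo_plus. \<forall>a\<in>A. \<bar>g a - f a\<bar> < \<epsilon>} \<subseteq> T"
proof -
  have "generate_topology_on
      {basic_open f as \<epsilon> | f as \<epsilon>. f \<in> Homeo_plus \<and> set as \<subseteq> {0..1} \<and> \<epsilon> > 0} T"
    using assms(1) by (simp add: H_top_def openin_topology_generated_by_iff)
  then show ?thesis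
    using assms(2)
  proof (induction arbitrary: f rule: generate_topology_on.induct)
    case Empty
    then show ?case by simp
  next
    case (Int S T)
    obtain A \<epsilon> where A: "finite A" "A \<subseteq> {0..1}" "0 < \<epsilon>"
        "{g \<in> Homeo_plus. \<forall>a\<in>A. \<bar>g a - f a\<bar> < \<epsilon>} \<subseteq> S"
      using Int.IH(1)[of f] Int.prems by auto
    obtain B \<delta> where B: "finite B" "B \<subseteq> {0..1}" "0 < \<delta>"
        "{g \<in> Homeo_plus. \<forall>a\<in>B. \<bar>g a - f a\<bar> < \<delta>} \<subseteq> T"
      using Int.IH(2)[of f] Int.prems by auto
    show ?case
      using A B by (intro exI[of _ "A \<union> B"] exI[of _ "min \<epsilon> \<delta>"]) auto
  next
    case (UN K)
    then obtain S where S: "S \<in> K" "f \<in> S"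
      by blast
    show ?case
      using UN.IH[OF S] S(1) by (meson Union_upper subset_trans)
  next
    case (Basis S)
    then obtain f0 as \<epsilon> where S: "S = basic_open f0 as \<epsilon>" "set as \<subseteq> {0..1}" "0 < \<epsilon>"
      by blast
    \<comment> \<open>The slack left at each point; inserting \<open>\<epsilon>\<close> covers the
      empty list.\<close>
    define \<delta> where "\<delta> = Min (insert \<epsilon> ((\<lambda>a. \<epsilon> - \<bar>f a - f0 a\<bar>) ` set as))"
    have "0 < \<delta>"
      using Basis.prems S by (auto simp: \<delta>_def basic_open_def)
    moreover have "\<bar>g a - f0 a\<bar> < \<epsilon>" if "a \<in> set as" "\<bar>g a - f a\<bar> < \<delta>" for g a
    proof -
      have "\<delta> \<le> \<epsilon> - \<bar>f a - f0 a\<bar>"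
        using that(1) by (auto simp: \<delta>_def)
      then show ?thesis
        using that(2) by linarith
    qed
    then have "{g \<in> Homeo_plus. \<forall>a\<in>set as. \<bar>g a - f a\<bar> < \<delta>} \<subseteq> S"
      unfolding S basic_open_def by blast
    ultimately show ?case
      using S(2) by (intro exI[of _ "set as"] exI[of _ \<delta>]) auto
  qed
qed

lemma openin_prod_H_top_nbhd:
  assumes "openin (prod_topology H_top H_top) V" "(g, h) \<in> V"
  obtains A \<epsilon> where "finite A" "A \<subseteq> {0..1}" "0 < \<epsilon>"
    "\<forall>g'\<in>Homeo_plus. \<forall>h'\<in>Homeo_plus.
       (\<forall>a\<in>A. \<bar>g' a - g a\<bar> < \<epsilon> \<and> \<bar>h' a - h a\<bar> < \<epsilon>) \<longrightarrow> (g', h') \<in> V"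
proof -
  have "\<exists>S T. openin H_top S \<and> openin H_top T \<and> g \<in> S \<and> h \<in> T \<and> S \<times> T \<subseteq> V"
    using assms(1)[unfolded openin_prod_topology_alt] assms(2) by simp
  then obtain S T where ST: "openin H_top S" "openin H_top T" "g \<in> S" "h \<in> T" "S \<times> T \<subseteq> V"
    by (elim exE conjE)
  obtain A \<epsilon> where A: "finite A" "A \<subseteq> {0..1}" "0 < \<epsilon>"
      "{g' \<in> Homeo_plus. \<forall>a\<in>A. \<bar>g' a - g a\<bar> < \<epsilon>} \<subseteq> S"
    using openin_H_top_nbhd[OF ST(1,3)] by blast
  obtain B \<delta> where B: "finite B" "B \<subseteq> {0..1}" "0 < \<delta>"
      "{h' \<in> Homeo_plus. \<forall>a\<in>B. \<bar>h' a - h a\<bar> < \<delta>} \<subseteq> T"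
    using openin_H_top_nbhd[OF ST(2,4)] by blast
  show thesis
  proof (rule that)
    show "finite (A \<union> B)" "A \<union> B \<subseteq> {0..1}" "0 < min \<epsilon> \<delta>"
      using A B by auto
    show "\<forall>g'\<in>Homeo_plus. \<forall>h'\<in>Homeo_plus.
        (\<forall>a\<in>A \<union> B. \<bar>g' a - g a\<bar> < min \<epsilon> \<delta> \<and> \<bar>h' a - h a\<bar> < min \<epsilon> \<delta>) \<longrightarrow> (g', h') \<in> V"
    proof (intro ballI impI)
      fix g' h'
      assume "g' \<in> Homeo_plus" "h' \<in> Homeo_plus"
        "\<forall>a\<in>A \<union> B. \<bar>g' a - g a\<bar> < min \<epsilon> \<delta> \<and> \<bar>h' a - h a\<bar> < min \<epsilon> \<delta>"
      then have "g' \<in> S" "h' \<in> T"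
        by (auto intro!: subsetD[OF A(4)] subsetD[OF B(4)])
      then show "(g', h') \<in> V"
        using ST(5) by blast
    qed
  qed
qed

section \<open>Joint continuity of evaluation and of words\<close>

lemma continuous_map_eval: "continuous_map H_top euclideanreal (\<lambda>f. f y)"
proof (cases "y \<in> {0..1}")
  case True
  have nb: "openin H_top {g \<in> Homeo_plus. \<bar>g y - f y\<bar> < \<epsilon>}" if "f \<in> Homeo_plus" "0 < \<epsilon>" for f \<epsilon>
  proof -
    have "basic_open f [y] \<epsilon> \<in>
        {basic_open f as \<epsilon> | f as \<epsilon>. f \<in> Homeo_plus \<and> set as \<subseteq> {0..1} \<and> \<epsilon> > 0}"
      using that True by (intro CollectI exI[of _ f] exI[of _ "[y]"] exI[of _ \<epsilon>]) auto
    then have "openin H_top (basic_open f [y] \<epsilon>)"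
      unfolding H_top_def by (rule topology_generated_by_Basis)
    then show ?thesis
      by (simp add: basic_open_def)
  qed
  have "openin H_top {f \<in> Homeo_plus. f y < r}" for r
  proof (subst openin_subopen, intro ballI)
    fix f assume "f \<in> {f \<in> Homeo_plus. f y < r}"
    then show "\<exists>T. openin H_top T \<and> f \<in> T \<and> T \<subseteq> {f \<in> Homeo_plus. f y < r}"
      using nb[of f "r - f y"] by (intro exI[of _ "{g \<in> Homeo_plus. \<bar>g y - f y\<bar> < r - f y}"]) auto
  qed
  moreover have "openin H_top {f \<in> Homeo_plus. f y > r}" for r
  proof (subst openin_subopen, intro ballI)
    fix f assume "f \<in> {f \<in> Homeo_plus. f y > r}"
    then show "\<exists>T. openin H_top T \<and> f \<in> T \<and> T \<subseteq> {f \<in> Homeo_plus. f y > r}"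
      using nb[of f "f y - r"] by (intro exI[of _ "{g \<in> Homeo_plus. \<bar>g y - f y\<bar> < f y - r}"]) auto
  qed
  ultimately show ?thesis
    by (simp add: continuous_map_upper_lower_semicontinuous_lt)
next
  case False
  show ?thesis
    by (rule continuous_map_eq[of _ _ "\<lambda>f. y"]) (auto simp: Homeo_plus_outside[OF _ False])
qed

text \<open>Although the topology is only pointwise, monotonicity makes evaluation jointly
  continuous: \<open>F p (z p) < r\<close> holds iff some constant \<open>y\<close> satisfies
  \<open>z p < y\<close> and \<open>F p y < r\<close>, and each of these conditions on
  \<open>p\<close> is open. Lower bounds are symmetric.\<close>

lemma continuous_map_apply:
  assumes F: "continuous_map T H_top F" and z: "continuous_map T euclideanreal z"
  shows "continuous_map T euclideanreal (\<lambda>p. F p (z p))"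
proof -
  have in_H: "F p \<in> Homeo_plus" if "p \<in> topspace T" for p
    using F that by (auto simp: continuous_map_def)
  have ev: "continuous_map T euclideanreal (\<lambda>p. F p y)" for y
    using continuous_map_compose[OF F continuous_map_eval[of y]] by (simp add: comp_def)
  have "{p \<in> topspace T. F p (z p) < r} =
      (\<Union>y. {p \<in> topspace T. z p < y} \<inter> {p \<in> topspace T. F p y < r})" for r
  proof (intro Set.set_eqI iffI)
    fix p assume p: "p \<in> {p \<in> topspace T. F p (z p) < r}"
    then have H: "F p \<in> Homeo_plus"
      using in_H by simp
    have "z p < inv_into UNIV (F p) r"
      using p Homeo_plus_less_iff[OF H] Homeo_plus_inverse(1)[OF H] by (metis mem_Collect_eq)
    then obtain y where "z p < y" "y < inv_into UNIV (F p) r"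
      using dense by blast
    moreover from this have "F p y < r"
      using Homeo_plus_less_iff[OF H] Homeo_plus_inverse(1)[OF H] by metis
    ultimately show "p \<in> (\<Union>y. {p \<in> topspace T. z p < y} \<inter> {p \<in> topspace T. F p y < r})"
      using p by blast
  next
    fix p assume "p \<in> (\<Union>y. {p \<in> topspace T. z p < y} \<inter> {p \<in> topspace T. F p y < r})"
    then obtain y where "p \<in> topspace T" "z p < y" "F p y < r"
      by blast
    then show "p \<in> {p \<in> topspace T. F p (z p) < r}"
      using Homeo_plus_less_iff[OF in_H, of p "z p" y] by simp
  qed
  moreover have "{p \<in> topspace T. F p (z p) > r} =
      (\<Union>y. {p \<in> topspace T. z p > y} \<inter> {p \<in> topspace T. F p y > r})" for r
  proof (intro Set.set_eqI iffI)
    fix p assume p: "p \<in> {p \<in> topspace T. F p (z p) > r}"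
    then have H: "F p \<in> Homeo_plus"
      using in_H by simp
    have "inv_into UNIV (F p) r < z p"
      using p Homeo_plus_less_iff[OF H] Homeo_plus_inverse(1)[OF H] by (metis mem_Collect_eq)
    then obtain y where "y < z p" "inv_into UNIV (F p) r < y"
      using dense by blast
    moreover from this have "r < F p y"
      using Homeo_plus_less_iff[OF H] Homeo_plus_inverse(1)[OF H] by metis
    ultimately show "p \<in> (\<Union>y. {p \<in> topspace T. z p > y} \<inter> {p \<in> topspace T. F p y > r})"
      using p by blast
  next
    fix p assume "p \<in> (\<Union>y. {p \<in> topspace T. z p > y} \<inter> {p \<in> topspace T. F p y > r})"
    then obtain y where "p \<in> topspace T" "z p > y" "F p y > r"
      by blast
    then show "p \<in> {p \<in> topspace T. F p (z p) > r}"
      using Homeo_plus_less_iff[OF in_H, of p y "z p"] by simp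
  qed
  ultimately show ?thesis
    using z ev unfolding continuous_map_upper_lower_semicontinuous_lt
    by (auto intro!: openin_Union openin_Int)
qed

text \<open>Monotonicity turns a bound on the inverse at the moving point \<open>z p\<close> into a
  comparison of \<open>z p\<close> with \<open>F p r\<close> at the constant point
  \<open>r\<close>.\<close>

lemma continuous_map_apply_inv:
  assumes F: "continuous_map T H_top F" and z: "continuous_map T euclideanreal z"
  shows "continuous_map T euclideanreal (\<lambda>p. inv_into UNIV (F p) (z p))"
proof -
  have in_H: "F p \<in> Homeo_plus" if "p \<in> topspace T" for p
    using F that by (auto simp: continuous_map_def)
  have less: "inv_into UNIV (F p) x < y \<longleftrightarrow> x < F p y" "y < inv_into UNIV (F p) x \<longleftrightarrow> F p y < x"
    if "p \<in> topspace T" for p x y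
    using Homeo_plus_less_iff[OF in_H[OF that]] Homeo_plus_inverse(1)[OF in_H[OF that]] by metis+
  have diff: "continuous_map T euclideanreal (\<lambda>p. F p r - z p)" for r
    using continuous_map_compose[OF F continuous_map_eval[of r]] z
    by (intro continuous_map_diff) (simp_all add: comp_def)
  have "{p \<in> topspace T. inv_into UNIV (F p) (z p) < r} = {p \<in> topspace T. F p r - z p > 0}"
    "{p \<in> topspace T. inv_into UNIV (F p) (z p) > r} = {p \<in> topspace T. F p r - z p < 0}" for r
    using less by auto
  then show ?thesis
    using diff unfolding continuous_map_upper_lower_semicontinuous_lt
    by (simp only: simp_thms)
qed

lemma continuous_map_word_map:
  "continuous_map (prod_topology H_top H_top) euclideanreal (\<lambda>p. word_map p w x)"
\<comment> \<open>The last letter acts last, so the induction hypothesis supplies the moving point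
  to which it is applied.\<close>
proof (induction w rule: rev_induct)
  case Nil
  then show ?case by simp
next
  case (snoc s w)
  obtain b e where s: "s = (b, e)"
    by fastforce
  have "continuous_map (prod_topology H_top H_top) H_top (\<lambda>p. if b then fst p else snd p)"
    by (cases b) (auto simp: continuous_map_fst continuous_map_snd)
  from continuous_map_apply[OF this snoc] continuous_map_apply_inv[OF this snoc]
  show ?case
    by (cases e) (auto simp: word_map_append s Let_def)
qed

section \<open>A countable neighbourhood base at the identity\<close>

definition id_nbhd :: "nat \<Rightarrow> (real \<Rightarrow> real) set" where
  "id_nbhd n = {g \<in> Homeo_plus. \<forall>i\<le>Suc n. \<bar>g (real i / real (Suc n)) - real i / real (Suc n)\<bar> < 1 / real (Suc n)}"

text \<open>A point lies between two neighbouring grid points, each displaced by less than the mesh;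
  by monotonicity its image is confined between their images.\<close>

lemma id_nbhd_close:
  assumes g: "g \<in> id_nbhd n" and a: "a \<in> {0..1}"
  shows "\<bar>g a - a\<bar> < 2 / real (Suc n)"
proof -
  define K where "K = real (Suc n)"
  define i where "i = nat \<lfloor>a * K\<rfloor>"
  have H: "g \<in> Homeo_plus"
    using g by (simp add: id_nbhd_def)
  have K: "0 < K"
    by (simp add: K_def)
  have i: "real i \<le> a * K" "a * K < real i + 1"
    using a K by (auto simp: i_def)
  have near: "\<bar>g (real j / K) - real j / K\<bar> < 1 / K" if "j \<le> Suc n" for j
    using g that by (simp add: id_nbhd_def K_def)
  show ?thesis
  \<comment> \<open>The point 1 has no grid point to its right, but it is fixed.\<close>
  proof (cases "a = 1")
    case True
    then show ?thesis
      using Homeo_plus_ends[OF H] by simp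
  next
    case False
    then have "a * K < K"
      using a K by simp
    then have "real i < real (Suc n)"
      using i unfolding K_def by linarith
    then have "i < Suc n"
      by linarith
    then have "\<bar>g (real i / K) - real i / K\<bar> < 1 / K" "\<bar>g (real (Suc i) / K) - real (Suc i) / K\<bar> < 1 / K"
      using near[of i] near[of "Suc i"] by auto
    moreover have lo: "real i / K \<le> a" and hi: "a < real (Suc i) / K"
      using i K by (auto simp: field_simps)
    then have "g (real i / K) \<le> g a" "g a < g (real (Suc i) / K)"
      using H by (auto simp: Homeo_plus_iff strict_mono_less strict_mono_less_eq)
    moreover have "real (Suc i) / K = real i / K + 1 / K"
      by (simp add: add_divide_distrib)
    ultimately show ?thesis
      using lo hi unfolding K_def[symmetric] by (simp add: abs_less_iff)
  qed
qed

text \<open>The grids are not nested, so the claim is made for all large \<open>n\<close> and not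
  for a single one. Countability of this family later yields countable covers.\<close>

lemma id_nbhd_subset:
  assumes "openin H_top T" "id \<in> T"
  shows "\<exists>N. \<forall>n\<ge>N. id_nbhd n \<subseteq> T"
proof -
  obtain A \<epsilon> where A: "A \<subseteq> {0..1}" "0 < \<epsilon>" "{g \<in> Homeo_plus. \<forall>a\<in>A. \<bar>g a - id a\<bar> < \<epsilon>} \<subseteq> T"
    using openin_H_top_nbhd[OF assms] by blast
  obtain N where N: "2 / \<epsilon> < real N"
    using reals_Archimedean2 by blast
  have "id_nbhd n \<subseteq> T" if "N \<le> n" for n
  proof -
    have "2 / \<epsilon> < real (Suc n)"
      using N that by linarith
    then have "2 / real (Suc n) < \<epsilon>"
      using A(2) by (simp add: field_simps)
    then have "\<bar>g a - a\<bar> < \<epsilon>" if "g \<in> id_nbhd n" "a \<in> A" for g a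
      using id_nbhd_close[OF that(1), of a] that(2) A(1) by fastforce
    then show ?thesis
      using A(3) by (auto simp: id_nbhd_def)
  qed
  then show ?thesis
    by blast
qed

lemma openin_Collect_id_nbhd:
  assumes "\<And>p. p \<in> topspace T \<Longrightarrow> F p \<in> Homeo_plus"
    and "\<And>y. continuous_map T euclideanreal (\<lambda>p. F p y)"
  shows "openin T {p \<in> topspace T. F p \<in> id_nbhd n}"
proof -
  let ?y = "\<lambda>i. real i / real (Suc n)"
  have "openin T {p \<in> topspace T. F p (?y i) \<in> ball (?y i) (1 / real (Suc n))}" for i
    using assms(2)[of "?y i"] by (rule openin_continuous_map_preimage) auto
  then have "openin T (\<Inter>i\<in>{..Suc n}. {p \<in> topspace T. F p (?y i) \<in> ball (?y i) (1 / real (Suc n))})"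
    by (intro openin_INT2) auto
  moreover have "{p \<in> topspace T. F p \<in> id_nbhd n} =
      (\<Inter>i\<in>{..Suc n}. {p \<in> topspace T. F p (?y i) \<in> ball (?y i) (1 / real (Suc n))})"
    using assms(1) by (auto simp: id_nbhd_def dist_real_def abs_minus_commute)
  ultimately show ?thesis
    by simp
qed

lemma nowhere_dense_inI:
  assumes "closedin T S" "\<And>V. openin T V \<Longrightarrow> V \<noteq> {} \<Longrightarrow> \<exists>x\<in>V. x \<notin> S"
  shows "nowhere_dense_in T S"
proof -
  have "T closure_of S = S"
    using assms(1) by (simp add: closure_of_closedin)
  moreover have "T interior_of S = {}"
    using assms(2)[of "T interior_of S"] interior_of_subset[of T S] by auto
  ultimately show ?thesis
    using closedin_subset[OF assms(1)] by (simp add: nowhere_dense_in_def)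
qed

section \<open>Pairs without common fixed points\<close>

lemma Homeo_plus_fixed_outside:
  assumes "f \<in> Homeo_plus" "x \<notin> {0<..<1}"
  shows "f x = x"
proof (cases "x \<in> {0..1}")
  case True
  then have "x = 0 \<or> x = 1"
    using assms(2) by auto
  then show ?thesis
    using Homeo_plus_ends[OF assms(1)] by auto
qed (rule Homeo_plus_outside[OF assms(1)])

section \<open>Interpolation by piecewise affine homeomorphisms\<close>

definition bend :: "real \<Rightarrow> real \<Rightarrow> real \<Rightarrow> real \<Rightarrow> real" where
  "bend q c d x =
     (if x \<le> q \<or> 1 \<le> x then x
      else if x \<le> c then q + (d - q) / (c - q) * (x - q)
      else 1 - (1 - d) / (1 - c) * (1 - x))"

lemma bend_range:
  assumes "q < c" "c < 1" "q < d" "d < 1"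
  shows "\<lbrakk>q < x; x \<le> c\<rbrakk> \<Longrightarrow> q < bend q c d x \<and> bend q c d x \<le> d"
    and "\<lbrakk>c < x; x < 1\<rbrakk> \<Longrightarrow> d < bend q c d x \<and> bend q c d x < 1"
proof -
  assume x: "q < x" "x \<le> c"
  have "(d - q) / (c - q) * (x - q) \<le> (d - q) / (c - q) * (c - q)"
    using x assms by (intro mult_left_mono) auto
  moreover have "0 < (d - q) / (c - q) * (x - q)"
    using x assms by simp
  ultimately show "q < bend q c d x \<and> bend q c d x \<le> d"
    using x assms by (simp add: bend_def)
next
  assume x: "c < x" "x < 1"
  have "(1 - d) / (1 - c) * (1 - x) < (1 - d) / (1 - c) * (1 - c)"
    using x assms by (intro mult_strict_left_mono) auto
  moreover have "0 < (1 - d) / (1 - c) * (1 - x)"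
    using x assms by simp
  ultimately show "d < bend q c d x \<and> bend q c d x < 1"
    using x assms by (simp add: bend_def)
qed

text \<open>\<open>bend q c d\<close> is affine on \<open>[q, c]\<close> and on
  \<open>[c, 1]\<close>, carries \<open>c\<close> to \<open>d\<close> and is the identity elsewhere.
  Exchanging \<open>c\<close> and \<open>d\<close> inverts it, which later gives
  surjectivity.\<close>

lemma bend_inverse:
  assumes "q < c" "c < 1" "q < d" "d < 1"
  shows "bend q d c (bend q c d x) = x"
proof -
  consider "x \<le> q \<or> 1 \<le> x" | "q < x" "x \<le> c" | "c < x" "x < 1"
    by linarith
  then show ?thesis
  proof cases
    case 1
    then show ?thesis by (simp add: bend_def)
  next
    case 2
    then have "q < bend q c d x \<and> bend q c d x \<le> d"
      using bend_range(1)[OF assms] by blast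
    then have "bend q d c (bend q c d x) = q + (c - q) / (d - q) * (bend q c d x - q)"
      using assms by (simp add: bend_def[of q d c])
    also have "bend q c d x - q = (d - q) / (c - q) * (x - q)"
      using 2 assms by (simp add: bend_def)
    finally show ?thesis
      using assms by simp
  next
    case 3
    then have "d < bend q c d x \<and> bend q c d x < 1"
      using bend_range(2)[OF assms] by blast
    then have "bend q d c (bend q c d x) = 1 - (1 - c) / (1 - d) * (1 - bend q c d x)"
      using assms by (simp add: bend_def[of q d c])
    also have "1 - bend q c d x = (1 - d) / (1 - c) * (1 - x)"
      using 3 assms by (simp add: bend_def)
    finally show ?thesis
      using assms by simp
  qed
qed

lemma bend_in_Homeo_plus:
  assumes "0 \<le> q" "q < c" "c < 1" "q < d" "d < 1"
  shows "bend q c d \<in> Homeo_plus"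
  unfolding Homeo_plus_iff
proof (intro conjI allI impI)
  show "strict_mono (bend q c d)"
  proof (rule strict_monoI)
    fix x y :: real assume xy: "x < y"
    note r = bend_range[OF assms(2-), of x] bend_range[OF assms(2-), of y]
    consider "x \<le> q \<or> 1 \<le> y" | "q < x" "y \<le> c" | "q < x" "x \<le> c" "c < y" "y < 1" | "c < x" "y < 1"
      by linarith
    then show "bend q c d x < bend q c d y"
    proof cases
      case 1
      have "x \<le> q \<Longrightarrow> bend q c d x = x" "1 \<le> x \<Longrightarrow> bend q c d x = x"
        "y \<le> q \<Longrightarrow> bend q c d y = y" "1 \<le> y \<Longrightarrow> bend q c d y = y"
        by (simp_all add: bend_def)
      then show ?thesis
        using 1 r xy assms by (smt (verit))
    next
      case 2
      have "(d - q) / (c - q) * (x - q) < (d - q) / (c - q) * (y - q)"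
        using xy assms by (intro mult_strict_left_mono) auto
      then show ?thesis
        using 2 xy assms by (simp add: bend_def)
    next
      case 3
      then show ?thesis
        using r by linarith
    next
      case 4
      have "(1 - d) / (1 - c) * (1 - y) < (1 - d) / (1 - c) * (1 - x)"
        using xy assms by (intro mult_strict_left_mono) auto
      then show ?thesis
        using 4 xy assms by (simp add: bend_def)
    qed
  qed
  show "surj (bend q c d)"
    using bend_inverse[OF assms(4,5,2,3)] by (metis surj_def)
  show "bend q c d x = x" if "x \<notin> {0..1}" for x
    using that assms by (auto simp: bend_def)
qed

text \<open>Induction over \<open>A\<close> in increasing order: each new point \<open>c\<close> is
  brought to \<open>\<phi> c\<close> by composing with a bend that leaves the values up to the
  previous maximum alone. The clause making \<open>g\<close> affine from the last point to 1 keeps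
  the new pieces affine, so each of them contributes at most one fixed point.\<close>

lemma interpolation_aux:
  fixes \<phi> :: "real \<Rightarrow> real"
  assumes "0 \<le> \<delta>" "\<delta> < 1" "finite A" "A \<subseteq> {\<delta><..<1}" "\<phi> ` A \<subseteq> {\<delta><..<1}" "strict_mono_on A \<phi>"
  shows "\<exists>g\<in>Homeo_plus. (\<forall>x\<le>\<delta>. g x = x) \<and> (\<forall>a\<in>A. g a = \<phi> a)
    \<and> (\<forall>x\<in>{Max (insert \<delta> A)..1}.
          g x = 1 - (1 - g (Max (insert \<delta> A))) / (1 - Max (insert \<delta> A)) * (1 - x))
    \<and> ((\<forall>a\<in>A. \<phi> a \<noteq> a) \<longrightarrow> finite {x \<in> {\<delta><..Max (insert \<delta> A)}. g x = x})"
  using assms(3-6)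
proof (induction A rule: finite_linorder_max_induct)
  case empty
  then show ?case
    using assms(2) by (intro bexI[of _ id]) (auto simp: id_in_Homeo_plus)
next
  case (insert c A)
  define a where "a = Max (insert \<delta> A)"
  define d where "d = \<phi> c"
  have "strict_mono_on A \<phi>"
    using insert.prems(3) by (auto simp: strict_mono_on_def)
  moreover have "A \<subseteq> {\<delta><..<1}" "\<phi> ` A \<subseteq> {\<delta><..<1}"
    using insert.prems by auto
  ultimately obtain g where g_all: "g \<in> Homeo_plus" "\<forall>x\<le>\<delta>. g x = x" "\<forall>a\<in>A. g a = \<phi> a"
    "\<forall>x\<in>{a..1}. g x = 1 - (1 - g a) / (1 - a) * (1 - x)"
    "(\<forall>a\<in>A. \<phi> a \<noteq> a) \<longrightarrow> finite {x \<in> {\<delta><..a}. g x = x}"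
    using insert.IH[folded a_def] by (elim meta_impE bexE conjE) (assumption | rule that)+
  note g = g_all(1) g_all(2)[rule_format] g_all(3)[rule_format] g_all(4)[rule_format] mp[OF g_all(5)]
  define b e where "b = g a" and "e = g c"
  have a: "a = \<delta> \<or> a \<in> A"
    using insert.hyps(1) Max_in[of "insert \<delta> A"] unfolding a_def by blast
  have a_ge: "x \<le> a" if "x \<in> insert \<delta> A" for x
    unfolding a_def using insert.hyps(1) that by (intro Max_ge) auto
  have c: "a < c" "c < 1" "\<delta> < d" "d < 1"
    using insert.hyps(2) insert.prems a by (auto simp: d_def)
  have "b < d"
    using a
  proof
    assume "a = \<delta>"
    then show "b < d"
      using c g(2) by (simp add: b_def)
  next
    assume "a \<in> A"
    then show "b < d"
      using g(3) insert.prems(3) c(1) by (simp add: b_def d_def strict_mono_on_def)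
  qed
  have \<delta>a: "\<delta> \<le> a"
    using a_ge by simp
  have ge: "g x \<le> g y \<longleftrightarrow> x \<le> y" for x y
    using Homeo_plus_less_iff[OF g(1), of y x] by linarith
  have "0 \<le> b"
    using ge[of 0 a] assms(1) \<delta>a by (simp add: b_def Homeo_plus_ends[OF g(1)])
  have "b < e" "e < 1"
    using Homeo_plus_less_iff[OF g(1), of a c] Homeo_plus_less_iff[OF g(1), of c 1] c
    by (auto simp: b_def e_def Homeo_plus_ends[OF g(1)])
  note bend = bend_in_Homeo_plus[OF \<open>0 \<le> b\<close> \<open>b < e\<close> \<open>e < 1\<close> \<open>b < d\<close> \<open>d < 1\<close>]
  \<comment> \<open>\<open>b\<close> and \<open>e\<close> are the current values at \<open>a\<close>
    and \<open>c\<close>; the bend fixes everything up to \<open>b\<close> and moves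
    \<open>e\<close> to the target \<open>d\<close>.\<close>
  define h where "h = bend b e d \<circ> g"
  have h_low: "h x = g x" if "x \<le> a" for x
    using ge[of x a] that by (simp add: h_def bend_def b_def)
  have hc: "h c = d"
    using \<open>b < e\<close> \<open>e < 1\<close> by (simp add: h_def bend_def e_def[symmetric])
  define r where "r = (d - b) / (c - a)"
  have gb: "1 - g x = (1 - b) / (1 - a) * (1 - x)" "g x - b = (1 - b) / (1 - a) * (x - a)"
    if "x \<in> {a..1}" for x
    using g(4)[OF that] c by (simp_all add: b_def[symmetric] field_simps)
  have "b < 1"
    using \<open>b < e\<close> \<open>e < 1\<close> by simp
  have h_mid: "h x = b + r * (x - a)" if x: "x \<in> {a<..c}" for x
  proof -
    have "b < g x" "g x \<le> e" "g x < 1"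
      using x ge[of x a] ge[of x c] \<open>e < 1\<close> by (auto simp: b_def e_def not_le[symmetric])
    then have "h x = b + (d - b) / (e - b) * (g x - b)"
      by (simp add: h_def bend_def)
    also have "e - b = (1 - b) / (1 - a) * (c - a)"
      using gb(2)[of c] c by (simp add: e_def)
    also have "g x - b = (1 - b) / (1 - a) * (x - a)"
      using gb(2)[of x] x c by simp
    finally show ?thesis
      using c \<open>b < 1\<close> by (simp add: r_def)
  qed
  have h_high: "h x = 1 - (1 - d) / (1 - c) * (1 - x)" if x: "x \<in> {c..1}" for x
  proof -
    consider "x = c" | "x = 1" | "c < x" "x < 1"
      using x by fastforce
    then show ?thesis
    proof cases
      case 1
      then show ?thesis using hc c by simp
    next
      case 2
      then show ?thesis by (simp add: h_def bend_def Homeo_plus_ends[OF g(1)])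
    next
      case 3
      have "e < g x" "g x < 1"
        using 3 Homeo_plus_less_iff[OF g(1), of c x] Homeo_plus_less_iff[OF g(1), of x 1]
        by (auto simp: e_def Homeo_plus_ends[OF g(1)])
      then have "h x = 1 - (1 - d) / (1 - e) * (1 - g x)"
        using \<open>b < e\<close> by (simp add: h_def bend_def)
      also have "1 - e = (1 - b) / (1 - a) * (1 - c)"
        using gb(1)[of c] c by (simp add: e_def)
      also have "1 - g x = (1 - b) / (1 - a) * (1 - x)"
        using gb(1)[of x] x c by simp
      finally show ?thesis
        using c \<open>b < 1\<close> by simp
    qed
  qed
  have Max_c: "Max (insert \<delta> (insert c A)) = c"
  proof (rule Max_eqI)
    show "y \<le> c" if "y \<in> insert \<delta> (insert c A)" for y
      using that insert.hyps(2) \<delta>a c(1) by fastforce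
  qed (use insert.hyps(1) in auto)
  have fin: "finite {x \<in> {\<delta><..c}. h x = x}" if "\<forall>a\<in>insert c A. \<phi> a \<noteq> a"
  proof -
    \<comment> \<open>On \<open>(a, c]\<close> the graph is a segment of slope \<open>r\<close>. A
      fixed point with \<open>r = 1\<close> would force \<open>c\<close> to be fixed too, so
      \<open>r \<noteq> 1\<close> and the equation has one solution.\<close>
    have "x = (b - r * a) / (1 - r)" if "x \<in> {a<..c}" "h x = x" for x
    proof -
      have eq: "b + r * (x - a) = x"
        using h_mid[OF that(1)] that(2) by simp
      have neq: "b + r * (c - a) \<noteq> c"
        using h_mid[of c] c hc \<open>\<forall>a\<in>insert c A. \<phi> a \<noteq> a\<close> by (auto simp: d_def)
      have "r \<noteq> 1"
        using eq neq by auto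
      then show ?thesis
        using eq by (simp add: field_simps)
    qed
    then have "y \<in> insert ((b - r * a) / (1 - r)) {x \<in> {\<delta><..a}. g x = x}"
      if "y \<in> {x \<in> {\<delta><..c}. h x = x}" for y
      using that h_low[of y] by (cases "y \<le> a") auto
    then have "{x \<in> {\<delta><..c}. h x = x} \<subseteq> insert ((b - r * a) / (1 - r)) {x \<in> {\<delta><..a}. g x = x}"
      by (rule subsetI)
    then show ?thesis
      using g(5) that by (meson finite_insert finite_subset insert_iff)
  qed
  show ?case
    unfolding Max_c
  proof (intro bexI[of _ h] conjI allI ballI impI)
    show "h \<in> Homeo_plus"
      unfolding h_def using bend g(1) by (rule Homeo_plus_comp)
    show "h x = x" if "x \<le> \<delta>" for x
      using h_low[of x] g(2)[OF that] that \<delta>a by simp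
    show "h x = \<phi> x" if "x \<in> insert c A" for x
      using that hc h_low[of x] g(3)[of x] a_ge[of x] by (auto simp: d_def)
    show "h x = 1 - (1 - h c) / (1 - c) * (1 - x)" if "x \<in> {c..1}" for x
      using h_high[OF that] hc by simp
    show "finite {x \<in> {\<delta><..c}. h x = x}" if "\<forall>a\<in>insert c A. \<phi> a \<noteq> a"
      using fin[OF that] .
  qed
qed

text \<open>For the finiteness only the last piece is left: the segment from \<open>(c, g c)\<close>
  to \<open>(1, 1)\<close> starts off the diagonal, so it meets the diagonal only at 1.\<close>

lemma Homeo_plus_interpolation:
  fixes \<phi> :: "real \<Rightarrow> real"
  assumes "0 \<le> \<delta>" "\<delta> < 1" "finite A" "A \<subseteq> {\<delta><..<1}" "\<phi> ` A \<subseteq> {\<delta><..<1}" "strict_mono_on A \<phi>"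
  obtains g where "g \<in> Homeo_plus" "\<And>x. x \<le> \<delta> \<Longrightarrow> g x = x" "\<And>a. a \<in> A \<Longrightarrow> g a = \<phi> a"
    "\<lbrakk>A \<noteq> {}; \<And>a. a \<in> A \<Longrightarrow> \<phi> a \<noteq> a\<rbrakk> \<Longrightarrow> finite {x \<in> {\<delta><..<1}. g x = x}"
proof -
  define c where "c = Max (insert \<delta> A)"
  obtain g where g_all: "g \<in> Homeo_plus" "\<forall>x\<le>\<delta>. g x = x" "\<forall>a\<in>A. g a = \<phi> a"
    "\<forall>x\<in>{c..1}. g x = 1 - (1 - g c) / (1 - c) * (1 - x)"
    "(\<forall>a\<in>A. \<phi> a \<noteq> a) \<longrightarrow> finite {x \<in> {\<delta><..c}. g x = x}"
    using interpolation_aux[OF assms, folded c_def] by (elim bexE conjE)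
  note g = g_all(1) g_all(2)[rule_format] g_all(3)[rule_format] g_all(4)[rule_format] mp[OF g_all(5)]
  have "finite {x \<in> {\<delta><..<1}. g x = x}" if "A \<noteq> {}" and neq: "\<And>a. a \<in> A \<Longrightarrow> \<phi> a \<noteq> a"
  proof -
    have "c \<in> insert \<delta> A"
      unfolding c_def using assms(3) by (intro Max_in) auto
    moreover obtain a where "a \<in> A"
      using \<open>A \<noteq> {}\<close> by blast
    then have "\<delta> < a" "a \<le> c"
      using assms(3,4) by (auto simp: c_def)
    ultimately have "c \<in> A"
      by auto
    then have c: "g c \<noteq> c" "c < 1"
      using g(3) neq assms(4) by auto
    have "x \<le> c" if "x < 1" "g x = x" for x
    proof (rule ccontr)
      assume "\<not> x \<le> c"
      then have "g x = 1 - (1 - g c) / (1 - c) * (1 - x)"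
        using that by (intro g(4)) auto
      then have "(1 - g c) / (1 - c) * (1 - x) = 1 * (1 - x)"
        using that by simp
      moreover have "1 - x \<noteq> 0"
        using that(1) by simp
      ultimately have "(1 - g c) / (1 - c) = 1"
        by (simp only: mult_cancel_right simp_thms)
      then show False
        using c by simp
    qed
    then have "{x \<in> {\<delta><..<1}. g x = x} \<subseteq> {x \<in> {\<delta><..c}. g x = x}"
      by auto
    then show ?thesis
      using g(5) neq finite_subset by blast
  qed
  then show thesis
    using that g by blast
qed

text \<open>For \<open>x\<close> in \<open>(0,1)\<close> the value \<open>squeeze s x\<close> determines \<open>s\<close>, so all but finitely many \<open>s\<close> remove given
  finitely many fixed points.\<close>

definition squeeze :: "real \<Rightarrow> real \<Rightarrow> real" where
  "squeeze s x = (if x \<in> {0..1} then x / (1 + s * (1 - x)) else x)"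

lemma squeeze_denominator:
  fixes s x :: real
  assumes "0 \<le> s" "x \<in> {0..1}"
  shows "1 \<le> 1 + s * (1 - x)"
  using assms by auto

lemma squeeze_in_Homeo_plus:
  assumes s: "0 \<le> s"
  shows "squeeze s \<in> Homeo_plus"
  unfolding Homeo_plus_iff
proof (intro conjI allI impI)
  have range: "squeeze s x \<in> {0..1}" if "x \<in> {0..1}" for x
  proof -
    have "0 \<le> s * (1 - x)"
      using s that by simp
    then have "x \<le> 1 + s * (1 - x)"
      using that by auto
    then show ?thesis
      using squeeze_denominator[OF s that] that by (simp add: squeeze_def)
  qed
  show "strict_mono (squeeze s)"
  proof (rule strict_monoI)
    fix x y :: real assume xy: "x < y"
    show "squeeze s x < squeeze s y"
    proof (cases "x \<in> {0..1} \<and> y \<in> {0..1}")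
      case True
      then have "1 \<le> 1 + s * (1 - x)" "1 \<le> 1 + s * (1 - y)"
        using squeeze_denominator[OF s] by auto
      moreover have "x * (1 + s * (1 - y)) < y * (1 + s * (1 - x))"
      proof -
        have "0 < (1 + s) * (y - x)"
          using xy s by simp
        also have "\<dots> = y * (1 + s * (1 - x)) - x * (1 + s * (1 - y))"
          by (simp add: algebra_simps)
        finally show ?thesis by simp
      qed
      ultimately show ?thesis
        using True by (simp add: squeeze_def divide_less_eq less_divide_eq)
    next
      case False
      then show ?thesis
        using xy range[of x] range[of y] by (auto simp: squeeze_def)
    qed
  qed
  have "y \<in> range (squeeze s)" for y
  proof (cases "y \<in> {0..1}")
    case True
    \<comment> \<open>Obtained by solving \<open>x / (1 + s * (1 - x)) = y\<close> for
      \<open>x\<close>.\<close>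
    define x where "x = (1 + s) * y / (1 + s * y)"
    have pos: "0 < 1 + s * y"
      using s True by (simp add: add_pos_nonneg)
    have x: "x \<in> {0..1}"
      using s True pos by (auto simp: x_def divide_simps algebra_simps)
    have "1 + s * (1 - x) = (1 + s) / (1 + s * y)"
      using pos by (simp add: x_def field_simps)
    then have "x / (1 + s * (1 - x)) = y"
      using pos s by (simp add: x_def)
    then have "squeeze s x = y"
      using x by (simp add: squeeze_def)
    then show ?thesis by blast
  next
    case False
    then have "y = squeeze s y"
      by (auto simp: squeeze_def)
    then show ?thesis
      by (rule range_eqI)
  qed
  then show "surj (squeeze s)"
    by blast
qed (auto simp: squeeze_def)

lemma squeeze_less:
  assumes "0 < s" "x \<in> {0<..<1}"
  shows "squeeze s x < x"
proof -
  have "1 < 1 + s * (1 - x)"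
    using assms by simp
  then have "x * 1 < x * (1 + s * (1 - x))"
    using assms by (intro mult_strict_left_mono) auto
  then show ?thesis
    using assms \<open>1 < 1 + s * (1 - x)\<close> by (simp add: squeeze_def divide_less_eq)
qed

lemma squeeze_close:
  assumes s: "0 \<le> s"
  shows "\<bar>squeeze s x - x\<bar> \<le> s"
proof (cases "x \<in> {0..1}")
  case True
  define k where "k = 1 + s * (1 - x)"
  have k: "1 \<le> k" "k \<le> 1 + s"
    using squeeze_denominator[OF s True] s True mult_left_mono[of "1 - x" 1 s] by (auto simp: k_def)
  have "x / k \<le> x"
    using k True by (simp add: divide_le_eq mult_le_cancel_left1)
  moreover have "x - x / k = x * (k - 1) / k"
    using k by (simp add: field_simps)
  moreover have "x * (k - 1) / k \<le> s"
  proof -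
    have "x * (k - 1) \<le> 1 * s"
      using True k by (intro mult_mono) auto
    also have "\<dots> \<le> s * k"
      using k s by (simp add: mult_le_cancel_left1)
    finally show ?thesis
      using k by (simp add: divide_le_eq)
  qed
  ultimately show ?thesis
    using True by (simp add: squeeze_def k_def)
qed (use s in \<open>auto simp: squeeze_def\<close>)

lemma squeeze_inj:
  assumes "0 \<le> s" "0 \<le> t" "x \<in> {0<..<1}" "squeeze s x = squeeze t x"
  shows "s = t"
proof -
  have "1 \<le> 1 + s * (1 - x)" "1 \<le> 1 + t * (1 - x)"
    using squeeze_denominator[of s x] squeeze_denominator[of t x] assms by auto
  then have "1 + s * (1 - x) = 1 + t * (1 - x)"
    using assms by (simp add: squeeze_def frac_eq_eq)
  then show ?thesis
    using assms by simp
qed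

lemma exists_squeeze_avoiding:
  assumes f: "f \<in> Homeo_plus" and "finite F" "F \<subseteq> {0<..<1}" "0 < \<epsilon>"
  obtains s where "0 < s" "s < \<epsilon>" "\<And>x. x \<in> F \<Longrightarrow> squeeze s (f x) \<noteq> x"
proof -
  have "finite {s. 0 < s \<and> squeeze s (f x) = x}" if "x \<in> F" for x
  proof -
    have "f x \<in> {0<..<1}"
      using that assms(3) Homeo_plus_interior[OF f] by blast
    then have "s = t" if "s \<in> {s. 0 < s \<and> squeeze s (f x) = x}" "t \<in> {s. 0 < s \<and> squeeze s (f x) = x}"
      for s t
      using that squeeze_inj[of s t "f x"] by simp
    \<comment> \<open>There is at most one such parameter; \<open>SOME\<close> names it if it
      exists.\<close>
    then have "{s. 0 < s \<and> squeeze s (f x) = x} \<subseteq> {SOME s. 0 < s \<and> squeeze s (f x) = x}"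
      by (metis (mono_tags, lifting) mem_Collect_eq singletonI someI_ex subsetI)
    then show ?thesis
      by (rule finite_subset) simp
  qed
  then have "finite (\<Union>x\<in>F. {s. 0 < s \<and> squeeze s (f x) = x})"
    using assms(2) by blast
  moreover have "infinite {0<..<\<epsilon>}"
    using assms(4) by simp
  ultimately obtain s where "s \<in> {0<..<\<epsilon>}" "s \<notin> (\<Union>x\<in>F. {s. 0 < s \<and> squeeze s (f x) = x})"
    by (meson finite_subset subsetI)
  then show thesis
    using that by auto
qed

text \<open>First \<open>g0\<close> is squeezed so that it fixes none of the relevant points, then
  replaced by an interpolant that is trivial up to \<open>\<delta>\<close> and has finitely many
  fixed points between \<open>\<delta>\<close> and 1. For the second map, an interpolant of
  \<open>h0\<close> that is trivial up to \<open>\<delta>\<close> is squeezed: this moves all points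
  of \<open>(0, \<delta>]\<close>, and the parameter avoids fixing any of those finitely many
  points.\<close>

lemma dense_no_common_fixed_point:
  assumes g0: "g0 \<in> Homeo_plus" and h0: "h0 \<in> Homeo_plus" and "finite A" "0 < \<epsilon>"
  obtains g h \<delta> where "g \<in> Homeo_plus" "h \<in> Homeo_plus" "0 < \<delta>"
    "\<And>x. x \<le> \<delta> \<Longrightarrow> g x = x" "\<And>x. x \<in> {0<..<1} \<Longrightarrow> g x \<noteq> x \<or> h x \<noteq> x"
    "\<And>a. a \<in> A \<Longrightarrow> \<bar>g a - g0 a\<bar> < \<epsilon>" "\<And>a. a \<in> A \<Longrightarrow> \<bar>h a - h0 a\<bar> < \<epsilon>"
proof -
  \<comment> \<open>The extra point 1/2 keeps \<open>B\<close> nonempty, as the finiteness of the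
    fixed points requires.\<close>
  define B :: "real set" where "B = insert (1/2) (A \<inter> {0<..<1})"
  have B: "finite B" "B \<subseteq> {0<..<1}" "B \<noteq> {}"
    using assms(3) by (auto simp: B_def)
  obtain t where t: "0 < t" "t < \<epsilon>" "\<And>x. x \<in> B \<Longrightarrow> squeeze t (g0 x) \<noteq> x"
    using exists_squeeze_avoiding[OF g0 B(1,2) assms(4)] by blast
  define g1 where "g1 = squeeze t \<circ> g0"
  have g1: "g1 \<in> Homeo_plus"
    using t(1) g0 by (auto simp: g1_def intro!: Homeo_plus_comp squeeze_in_Homeo_plus)
  \<comment> \<open>Half the minimum, so that all prescribed arguments and values lie strictly above
    \<open>\<delta>\<close>.\<close>
  define \<delta> where "\<delta> = Min (B \<union> g1 ` B \<union> h0 ` B) / 2"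
  have pos: "x \<in> {0<..<1}" if "x \<in> B \<union> g1 ` B \<union> h0 ` B" for x
    using that B(2) Homeo_plus_interior[OF g1] Homeo_plus_interior[OF h0] by blast
  have fin: "finite (B \<union> g1 ` B \<union> h0 ` B)" "B \<union> g1 ` B \<union> h0 ` B \<noteq> {}"
    using B by auto
  then have "Min (B \<union> g1 ` B \<union> h0 ` B) \<in> {0<..<1}"
    by (intro pos Min_in)
  then have \<delta>: "0 < \<delta>" "\<delta> < 1"
    by (auto simp: \<delta>_def)
  have \<delta>_less: "x \<in> {\<delta><..<1}" if "x \<in> B \<union> g1 ` B \<union> h0 ` B" for x
    using Min_le[OF fin(1) that] pos[OF that] \<delta> by (auto simp: \<delta>_def)
  have sub: "B \<subseteq> {\<delta><..<1}" "g1 ` B \<subseteq> {\<delta><..<1}" "h0 ` B \<subseteq> {\<delta><..<1}"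
    by (rule subsetI, rule \<delta>_less, simp)+
  have mono: "strict_mono_on B f" if "f \<in> Homeo_plus" for f
    using that by (simp add: strict_mono_on_def Homeo_plus_less_iff)
  obtain g where g: "g \<in> Homeo_plus" "\<And>x. x \<le> \<delta> \<Longrightarrow> g x = x" "\<And>a. a \<in> B \<Longrightarrow> g a = g1 a"
    "finite {x \<in> {\<delta><..<1}. g x = x}"
  proof (rule Homeo_plus_interpolation[OF less_imp_le[OF \<delta>(1)] \<delta>(2) B(1) sub(1,2) mono[OF g1]])
  qed (use t(3) B(3) in \<open>auto simp: g1_def\<close>)
  obtain h1 where h1: "h1 \<in> Homeo_plus" "\<And>x. x \<le> \<delta> \<Longrightarrow> h1 x = x" "\<And>a. a \<in> B \<Longrightarrow> h1 a = h0 a"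
    by (rule Homeo_plus_interpolation[OF less_imp_le[OF \<delta>(1)] \<delta>(2) B(1) sub(1,3) mono[OF h0]]) (rule that)
  obtain s where s: "0 < s" "s < \<epsilon>" "\<And>x. x \<in> {x \<in> {\<delta><..<1}. g x = x} \<Longrightarrow> squeeze s (h1 x) \<noteq> x"
  proof (rule exists_squeeze_avoiding[OF h1(1) g(4) _ assms(4)])
    show "{x \<in> {\<delta><..<1}. g x = x} \<subseteq> {0<..<1}"
      using \<delta>(1) by auto
  qed (rule that)
  define h where "h = squeeze s \<circ> h1"
  have h: "h \<in> Homeo_plus"
    using s(1) h1(1) by (auto simp: h_def intro!: Homeo_plus_comp squeeze_in_Homeo_plus)
  show thesis
  proof (rule that[OF g(1) h \<delta>(1) g(2)])
    show "g x \<noteq> x \<or> h x \<noteq> x" if "x \<in> {0<..<1}" for x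
    proof (cases "x \<le> \<delta>")
      case True
      then show ?thesis
        using h1(2)[of x] squeeze_less[OF s(1) that] by (simp add: h_def)
    next
      case False
      then show ?thesis
        using s(3)[of x] that by (auto simp: h_def)
    qed
    fix a assume "a \<in> A"
    show "\<bar>g a - g0 a\<bar> < \<epsilon>"
    proof (cases "a \<in> {0<..<1}")
      case True
      then have "g a = squeeze t (g0 a)"
        using g(3)[of a] \<open>a \<in> A\<close> by (auto simp: B_def g1_def)
      then show ?thesis
        using squeeze_close[of t "g0 a"] t by simp
    qed (use assms(4) in \<open>simp add: Homeo_plus_fixed_outside[OF g(1)] Homeo_plus_fixed_outside[OF g0]\<close>)
    show "\<bar>h a - h0 a\<bar> < \<epsilon>"
    proof (cases "a \<in> {0<..<1}")
      case True
      then have "h a = squeeze s (h0 a)"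
        using h1(3)[of a] \<open>a \<in> A\<close> by (auto simp: B_def h_def)
      then show ?thesis
        using squeeze_close[of s "h0 a"] s by simp
    qed (use assms(4) in \<open>simp add: Homeo_plus_fixed_outside[OF h] Homeo_plus_fixed_outside[OF h0]\<close>)
  qed
qed

section \<open>Trajectories along words\<close>

lemma exists_word_below:
  assumes g: "g \<in> Homeo_plus" and h: "h \<in> Homeo_plus"
    and no_fix: "\<And>x. x \<in> {0<..<1} \<Longrightarrow> g x \<noteq> x \<or> h x \<noteq> x"
    and "0 < m" "M \<in> {0<..<1}"
  shows "\<exists>w. reduced_word w \<and> word_map (g, h) w M < m"
proof -
  let ?p = "(g, h)"
  define I where "I = (INF w. word_map ?p w M)"
  have p: "?p \<in> Homeo_plus \<times> Homeo_plus"
    using g h by simp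
  have pos: "0 < word_map ?p w M" for w
    using Homeo_plus_interior[OF word_map_in_Homeo_plus[OF p], of w M] assms(5) by simp
  have bdd: "bdd_below (range (\<lambda>w. word_map ?p w M))"
    by (rule bdd_belowI[of _ 0]) (use pos in \<open>auto intro: less_imp_le\<close>)
  have lower: "I \<le> word_map ?p w M" for w
    unfolding I_def using bdd by (rule cINF_lower) simp
  have "\<exists>w. word_map ?p w M < m"
  proof (cases "I < m")
    case True
    then show ?thesis
      unfolding I_def using cINF_less_iff[OF _ bdd] by auto
  next
    case False
    have "I \<in> {0<..<1}"
      using False assms(4,5) lower[of "[]"] by auto
    then obtain f s where f: "f \<in> Homeo_plus" "f I \<noteq> I"
      "letter_map ?p (s, True) = f" "letter_map ?p (s, False) = inv_into UNIV f"
    proof (cases "g I = I")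
      case True
      then show thesis
        using that[of h False] no_fix[of I] h \<open>I \<in> {0<..<1}\<close> by simp
    next
      case False
      then show thesis
        using that[of g True] g by simp
    qed
    have "\<exists>l. letter_map ?p l I < I"
    proof (cases "f I < I")
      case True
      then show ?thesis
        by (intro exI[of _ "(s, True)"]) (simp only: f(3))
    next
      case False
      then have "I < f I"
        using f(2) by simp
      then have "inv_into UNIV f I < I"
        using Homeo_plus_less_iff[OF f(1)] Homeo_plus_inverse(1)[OF f(1)] by metis
      then show ?thesis
        by (intro exI[of _ "(s, False)"]) (simp only: f(4))
    qed
    then obtain l where l: "letter_map ?p l I < I"
      by blast
    \<comment> \<open>The inverse letter raises the infimum, so some orbit point lies below the
      raised value; applying \<open>l\<close> to that orbit point gives one below \<open>I\<close>,
      which is absurd.\<close>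
    have "I < letter_map ?p (letter_inv l) I"
      using l Homeo_plus_less_iff[OF letter_map_in_Homeo_plus[OF p]] letter_map_letter_inv[OF p]
      by metis
    then obtain w where "word_map ?p w M < letter_map ?p (letter_inv l) I"
      unfolding I_def using cINF_less_iff[OF _ bdd] by auto
    then have "letter_map ?p l (word_map ?p w M) < I"
      using Homeo_plus_less_iff[OF letter_map_in_Homeo_plus[OF p]]
        letter_map_letter_inv[OF p] letter_inv_inv by metis
    then have "word_map ?p (w @ [l]) M < I"
      by (simp add: word_map_append)
    then show ?thesis
      using lower[of "w @ [l]"] by simp
  qed
  then show ?thesis
    using exists_reduced_word p by metis
qed

section \<open>Density of pairs with a nontrivial word near the identity\<close>

lemma exponent_sum_append: "exponent_sum (u @ v) = exponent_sum u + exponent_sum v"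
  by (simp add: exponent_sum_def)

lemma exponent_sum_word_inv: "exponent_sum (word_inv w) = - exponent_sum w"
  by (induction w) (auto simp: exponent_sum_def word_inv_def letter_inv_def)

text \<open>For a nearby pair without common fixed points and with \<open>g\<close> trivial up to
  \<open>\<delta>\<close>, a word \<open>u\<close> pushes all points up to \<open>M\<close> below
  \<open>\<delta>\<close>; conjugating \<open>g\<close> by \<open>u\<close> gives a word that fixes
  these points.\<close>

lemma dense_near_id:
  assumes "openin (prod_topology H_top H_top) V" "V \<noteq> {}"
  shows "\<exists>p\<in>V. \<exists>w. w \<noteq> [] \<and> reduced_word w \<and> word_map p w \<in> id_nbhd n"
proof -
  obtain g0 h0 where V: "(g0, h0) \<in> V"
    using assms(2) by auto
  then have H0: "g0 \<in> Homeo_plus" "h0 \<in> Homeo_plus"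
    using openin_subset[OF assms(1)] by auto
  obtain A \<epsilon> where A: "finite A" "A \<subseteq> {0..1}" "0 < \<epsilon>"
    "\<forall>g'\<in>Homeo_plus. \<forall>h'\<in>Homeo_plus.
       (\<forall>a\<in>A. \<bar>g' a - g0 a\<bar> < \<epsilon> \<and> \<bar>h' a - h0 a\<bar> < \<epsilon>) \<longrightarrow> (g', h') \<in> V"
    by (rule openin_prod_H_top_nbhd[OF assms(1) V]) (rule that)
  obtain g h \<delta> where g: "g \<in> Homeo_plus" and h: "h \<in> Homeo_plus" and \<delta>: "0 < \<delta>"
    and g_id: "\<And>x. x \<le> \<delta> \<Longrightarrow> g x = x"
    and no_fix: "\<And>x. x \<in> {0<..<1} \<Longrightarrow> g x \<noteq> x \<or> h x \<noteq> x"
    and near: "\<And>a. a \<in> A \<Longrightarrow> \<bar>g a - g0 a\<bar> < \<epsilon>" "\<And>a. a \<in> A \<Longrightarrow> \<bar>h a - h0 a\<bar> < \<epsilon>"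
    by (rule dense_no_common_fixed_point[OF H0 A(1,3)]) (rule that)
  have p: "(g, h) \<in> Homeo_plus \<times> Homeo_plus"
    using g h by simp
  \<comment> \<open>Every grid point of \<open>id_nbhd n\<close> other than 1 is at most
    \<open>M\<close>, and 1 is always fixed.\<close>
  define M where "M = real (Suc n) / real (Suc (Suc n))"
  have "M \<in> {0<..<1}"
    by (simp add: M_def)
  then obtain u where u: "word_map (g, h) u M < \<delta>"
    using exists_word_below[OF g h no_fix \<delta>] by blast
  define w0 where "w0 = u @ [(True, True)] @ word_inv u"
  have fixed: "word_map (g, h) w0 x = x" if "x \<le> M" for x
  proof -
    have "word_map (g, h) u x \<le> word_map (g, h) u M"
      using that Homeo_plus_less_iff[OF word_map_in_Homeo_plus[OF p], of u M x] by linarith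
    then have "g (word_map (g, h) u x) = word_map (g, h) u x"
      using u by (intro g_id) simp
    then show ?thesis
      by (simp add: w0_def word_map_append word_map_word_inv[OF p])
  qed
  have "word_map (g, h) w0 \<in> id_nbhd n"
    unfolding id_nbhd_def
  proof (intro CollectI conjI allI impI)
    show H: "word_map (g, h) w0 \<in> Homeo_plus"
      by (rule word_map_in_Homeo_plus[OF p])
    fix i assume i: "i \<le> Suc n"
    have "word_map (g, h) w0 (real i / real (Suc n)) = real i / real (Suc n)"
    proof (cases "i = Suc n")
      case True
      then show ?thesis
        using Homeo_plus_ends[OF H] by simp
    next
      case False
      then have "real i \<le> real n"
        using i by simp
      then have "real i / real (Suc n) \<le> real n / real (Suc n)"
        by (rule divide_right_mono) simp
      also have "\<dots> \<le> M"
        by (simp add: M_def field_simps)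
      finally show ?thesis
        by (rule fixed)
    qed
    then show "\<bar>word_map (g, h) w0 (real i / real (Suc n)) - real i / real (Suc n)\<bar> < 1 / real (Suc n)"
      by simp
  qed
  \<comment> \<open>Reduction could in principle cancel everything; the exponent sum 1 excludes the
    empty word.\<close>
  moreover obtain w where "reduced_word w" "exponent_sum w = exponent_sum w0"
      "word_map (g, h) w = word_map (g, h) w0"
    using exists_reduced_word[of w0] p by blast
  moreover have "exponent_sum w0 = 1"
    unfolding w0_def exponent_sum_append exponent_sum_word_inv by (simp add: exponent_sum_def)
  moreover have "(g, h) \<in> V"
    using A(4) g h near by simp
  ultimately show ?thesis
    by (intro bexI[of _ "(g, h)"] exI[of _ w]) (auto simp: exponent_sum_def)
qed

section \<open>Homeomorphisms with a prescribed trajectory\<close>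

lemma Homeo_plus_extension:
  assumes "finite D" "D \<subseteq> {0<..<1} \<times> {0<..<1}"
    and mono: "\<And>P Q. P \<in> D \<Longrightarrow> Q \<in> D \<Longrightarrow> fst P < fst Q \<longleftrightarrow> snd P < snd Q"
  shows "\<exists>f\<in>Homeo_plus. \<forall>(a, b)\<in>D. f a = b"
proof -
  define \<phi> where "\<phi> a = snd (SOME P. P \<in> D \<and> fst P = a)" for a
  have \<phi>: "\<phi> (fst P) = snd P" if "P \<in> D" for P
  proof -
    define Q where "Q = (SOME Q. Q \<in> D \<and> fst Q = fst P)"
    have "Q \<in> D \<and> fst Q = fst P"
      unfolding Q_def by (rule someI[of _ P]) (simp add: that)
    then show ?thesis
      using mono[of P Q] mono[of Q P] that by (simp add: \<phi>_def Q_def[symmetric])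
  qed
  have sm: "strict_mono_on (fst ` D) \<phi>"
    unfolding strict_mono_on_def using mono \<phi> by auto
  have sub: "fst ` D \<subseteq> {0<..<1}" "\<phi> ` fst ` D \<subseteq> {0<..<1}"
    using assms(2) \<phi> by fastforce+
  obtain f where f: "f \<in> Homeo_plus" "\<And>a. a \<in> fst ` D \<Longrightarrow> f a = \<phi> a"
    by (rule Homeo_plus_interpolation[OF order_refl zero_less_one finite_imageI[OF assms(1)] sub sm])
      (rule that)
  show ?thesis
  proof (intro bexI[of _ f] ballI, clarify)
    fix a b assume "(a, b) \<in> D"
    then show "f a = b"
      using f(2)[of a] \<phi>[of "(a, b)"] by force
  qed (rule f(1))
qed

text \<open>The sign \<open>\<sigma>\<close> treats escape towards \<open>0\<close> and towards \<open>1\<close> simultaneously.\<close>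

lemma exists_escaping_path:
  fixes x :: "nat \<Rightarrow> real"
  assumes x: "\<And>i. x i \<in> {0<..<1}" and "0 < m" "M < 1" and xt: "x t \<notin> {m..M}"
    and before: "\<forall>i<t. x i \<in> {m..M}"
  shows "\<exists>y. \<exists>\<sigma>::real. (\<forall>i\<le>t. y i = x i) \<and> (\<forall>i. y i \<in> {0<..<1}) \<and> (\<sigma> = 1 \<or> \<sigma> = - 1)
    \<and> (\<forall>i\<ge>t. \<forall>v\<in>{m..M}. \<sigma> * y i < \<sigma> * v) \<and> (\<forall>i j. t \<le> Suc i \<longrightarrow> i < j \<longrightarrow> \<sigma> * y j < \<sigma> * y i)"
proof -
  have *: ?thesis
    if y: "\<And>i. i \<le> t \<Longrightarrow> y i = x i" "\<And>i. y i \<in> {0<..<1}" and \<sigma>: "\<sigma> = 1 \<or> \<sigma> = - 1"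
      and out: "\<And>v. v \<in> {m..M} \<Longrightarrow> \<sigma> * y t < \<sigma> * v"
      and step: "\<And>i. t \<le> i \<Longrightarrow> \<sigma> * y (Suc i) < \<sigma> * y i" for y and \<sigma> :: real
  proof -
    \<comment> \<open>The step into time \<open>t\<close> also goes in the direction of escape,
      since it starts from a point still in \<open>[m, M]\<close>; hence the shift in
      \<open>t \<le> Suc i\<close>.\<close>
    have step': "\<sigma> * y (Suc i) < \<sigma> * y i" if "t \<le> Suc i" for i
    proof (cases "t = Suc i")
      case True
      then show ?thesis
        using out[of "y i"] before y(1)[of i] by simp
    next
      case False
      then show ?thesis
        using step[of i] that by simp
    qed
    have lt: "\<sigma> * y j < \<sigma> * y i" if "t \<le> Suc i" "i < j" for i j
      using that(2)
    proof (induction j rule: less_induct)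
      case (less j)
      show ?case
      proof (cases "j = Suc i")
        case True
        then show ?thesis
          using step'[OF that(1)] by simp
      next
        case False
        then obtain k where k: "j = Suc k" "i < k"
          using less.prems by (cases j) auto
        then show ?thesis
          using less.IH[of k] step'[of k] that(1) by simp
      qed
    qed
    have "\<sigma> * y i < \<sigma> * v" if "t \<le> i" "v \<in> {m..M}" for i v
      using out[OF that(2)] lt[of t i] that(1) by (cases "i = t") auto
    then show ?thesis
      using y \<sigma> lt by (intro exI[of _ y] exI[of _ \<sigma>] conjI allI ballI impI) simp_all
  qed
  have pow: "0 < u / 2 ^ k" "u / 2 ^ k \<le> u" "u / 2 ^ Suc k < u / 2 ^ k" if "0 < u" for u :: real and k
    using that by (auto simp: divide_simps mult_le_cancel_left1)
  show ?thesis
  proof (cases "x t < m")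
    case True
    \<comment> \<open>From time \<open>t\<close> on, the distance to the endpoint 0 is halved at
      each step; the other case does the same at 1.\<close>
    define y where "y i = (if i \<le> t then x i else x t / 2 ^ (i - t))" for i
    have y_ge: "y i = x t / 2 ^ (i - t)" if "t \<le> i" for i
      using that by (simp add: y_def)
    show ?thesis
    proof (rule *[of y 1])
      show "y i \<in> {0<..<1}" for i
      proof (cases "i \<le> t")
        case False
        have "0 < x t" "x t < 1"
          using x[of t] by auto
        moreover have "y i = x t / 2 ^ (i - t)"
          using False by (simp add: y_def)
        ultimately show ?thesis
          using pow(1,2)[OF \<open>0 < x t\<close>, of "i - t"] unfolding greaterThanLessThan_iff by linarith
      qed (use x[of i] in \<open>simp add: y_def\<close>)
      show "1 * y (Suc i) < 1 * y i" if "t \<le> i" for i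
        using that pow(3)[of "x t" "i - t"] x[of t] by (simp add: y_ge Suc_diff_le)
      show "1 * y t < 1 * v" if "v \<in> {m..M}" for v
        using that True by (simp add: y_def)
    qed (auto simp: y_def)
  next
    case False
    then have "M < x t"
      using xt by simp
    define y where "y i = (if i \<le> t then x i else 1 - (1 - x t) / 2 ^ (i - t))" for i
    have y_ge: "y i = 1 - (1 - x t) / 2 ^ (i - t)" if "t \<le> i" for i
      using that by (simp add: y_def)
    show ?thesis
    proof (rule *[of y "- 1"])
      show "y i \<in> {0<..<1}" for i
      proof (cases "i \<le> t")
        case False
        have "0 < 1 - x t" "1 - x t < 1"
          using x[of t] by auto
        moreover have "y i = 1 - (1 - x t) / 2 ^ (i - t)"
          using False by (simp add: y_def)
        ultimately show ?thesis
          using pow(1,2)[OF \<open>0 < 1 - x t\<close>, of "i - t"] unfolding greaterThanLessThan_iff by linarith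
      qed (use x[of i] in \<open>simp add: y_def\<close>)
      show "- 1 * y (Suc i) < - 1 * y i" if "t \<le> i" for i
        using that pow(3)[of "1 - x t" "i - t"] x[of t] by (simp add: y_ge Suc_diff_le)
      show "- 1 * y t < - 1 * v" if "v \<in> {m..M}" for v
        using that \<open>M < x t\<close> by (simp add: y_def)
    qed (auto simp: y_def)
  qed
qed

text \<open>The trajectory of \<open>c\<close> is kept until it first leaves \<open>[m, M]\<close>
  and then replaced by a monotone path towards an endpoint. Each letter demands one pair of argument
  and value from its generator. For each generator these demands and the data on \<open>A\<close>
  form a finite strictly increasing relation, which extends to a homeomorphism. The new pair moves
  \<open>c\<close> along the path, so the whole word ends outside \<open>[m, M]\<close>.\<close>

lemma exists_escaping_pair:
  assumes g: "g \<in> Homeo_plus" and h: "h \<in> Homeo_plus" and "finite A" and red: "reduced_word w"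
    and m: "0 < m" and M: "M < 1"
    and data: "\<And>a. a \<in> A \<Longrightarrow> a \<in> {0<..<1} \<Longrightarrow> a \<in> {m..M} \<and> g a \<in> {m..M} \<and> h a \<in> {m..M}"
    and c: "c \<in> {m..M}" and "s \<le> length w" "word_map (g, h) (take s w) c \<notin> {m..M}"
  shows "\<exists>g'\<in>Homeo_plus. \<exists>h'\<in>Homeo_plus.
           (\<forall>a\<in>A. g' a = g a \<and> h' a = h a) \<and> word_map (g', h') w c \<notin> {m..M}"
proof -
  have p: "(g, h) \<in> Homeo_plus \<times> Homeo_plus"
    using g h by simp
  define x where "x i = word_map (g, h) (take i w) c" for i
  define t where "t = (LEAST i. x i \<notin> {m..M})"
  have xs: "x s \<notin> {m..M}"
    using assms(10) by (simp add: x_def)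
  have xt: "x t \<notin> {m..M}"
    unfolding t_def using xs by (rule LeastI)
  have before: "x i \<in> {m..M}" if "i < t" for i
    using not_less_Least[OF that[unfolded t_def]] by blast
  have "t \<le> s"
    unfolding t_def using xs by (rule Least_le)
  then have t: "t \<le> length w"
    using assms(9) by simp
  have "c \<in> {0<..<1}"
    using c m M by auto
  then have x_in: "x i \<in> {0<..<1}" for i
    unfolding x_def using Homeo_plus_interior[OF word_map_in_Homeo_plus[OF p]] by blast
  have x_step: "x (Suc i) = letter_map (g, h) (w ! i) (x i)" if "i < length w" for i
    using that by (simp add: x_def take_Suc_conv_app_nth word_map_append)
  have "\<forall>i<t. x i \<in> {m..M}"
    using before by blast
  then obtain y and \<sigma> :: real where y: "\<forall>i\<le>t. y i = x i" "\<forall>i. y i \<in> {0<..<1}"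
    and \<sigma>: "\<sigma> = 1 \<or> \<sigma> = - 1"
    and y': "\<forall>i\<ge>t. \<forall>v\<in>{m..M}. \<sigma> * y i < \<sigma> * v"
      "\<forall>i j. t \<le> Suc i \<longrightarrow> i < j \<longrightarrow> \<sigma> * y j < \<sigma> * y i"
    using exists_escaping_path[of x m M t, OF x_in m M xt] by (elim meta_impE exE conjE)
  note y_eq = y(1)[rule_format] and y_in = y(2)[rule_format]
    and y_out = y'(1)[rule_format] and y_dec = y'(2)[rule_format]
  define f where "f b = (if b then g else h)" for b
  have f: "f b \<in> Homeo_plus" for b
    using g h by (simp add: f_def)
  \<comment> \<open>The demand of letter \<open>i\<close> on its generator; an inverted letter
    carries \<open>y i\<close> to \<open>y (Suc i)\<close> iff the generator carries
    \<open>y (Suc i)\<close> back to \<open>y i\<close>.\<close>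
  define E where "E i = (if snd (w ! i) then (y i, y (Suc i)) else (y (Suc i), y i))" for i
  define D where "D b = (\<lambda>a. (a, f b a)) ` (A \<inter> {0<..<1}) \<union> E ` {i. i < length w \<and> fst (w ! i) = b}" for b
  \<comment> \<open>Comparison in the direction of escape; \<open>D b\<close> extends to a
    homeomorphism once any two distinct members are related by \<open>lt\<close> in one order or the
    other.\<close>
  define lt where "lt P Q \<longleftrightarrow> \<sigma> * fst P < \<sigma> * fst Q \<and> \<sigma> * snd P < \<sigma> * snd Q" for P Q :: "real \<times> real"
  have old: "snd (E i) = f (fst (w ! i)) (fst (E i))" if "i < t" for i
  proof -
    obtain b e where be: "w ! i = (b, e)"
      by fastforce
    have "y (Suc i) = letter_map (g, h) (b, e) (y i)"
      using x_step[of i] that t y_eq[of i] y_eq[of "Suc i"] be by simp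
    then show ?thesis
      using Homeo_plus_inverse(1)[OF f[of b]] by (auto simp: E_def be f_def Let_def)
  qed
  have graph: "P = Q \<or> lt P Q \<or> lt Q P" if "snd P = f b (fst P)" "snd Q = f b (fst Q)" for P Q b
    using that \<sigma> Homeo_plus_less_iff[OF f, of b "fst P" "fst Q"] Homeo_plus_less_iff[OF f, of b "fst Q" "fst P"]
    by (cases "fst P" "fst Q" rule: linorder_cases) (auto simp: lt_def prod_eq_iff)
  \<comment> \<open>After the exit both coordinates of a demand lie beyond
    \<open>[m, M]\<close>.\<close>
  have new_old: "lt (E i) Q" if "t \<le> i" "fst Q \<in> {m..M}" "snd Q \<in> {m..M}" for i Q
    using y_out[of i] y_out[of "Suc i"] that by (simp add: lt_def E_def)
  \<comment> \<open>The only possible conflict is between a letter and an immediately following inverse letter.\<close>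
  have new_new: "lt (E j) (E i)" if "t \<le> Suc i" "i < j" "j < length w" "fst (w ! i) = fst (w ! j)" for i j
  proof (cases "snd (w ! i) = snd (w ! j)")
    case True
    then show ?thesis
      using y_dec[of i j] y_dec[of "Suc i" "Suc j"] that by (simp add: lt_def E_def)
  next
    case False
    then have "w ! j = letter_inv (w ! i)"
      using that(4) by (auto simp: letter_inv_def prod_eq_iff)
    then have "j \<noteq> Suc i"
      using reduced_word_nth[OF red, of i] that(3) by auto
    then show ?thesis
      using False y_dec[of i "Suc j"] y_dec[of "Suc i" j] that by (auto simp: lt_def E_def)
  qed
  \<comment> \<open>The letter with \<open>Suc i = t\<close> leads from inside \<open>[m, M]\<close>
    to outside, so it is grouped with the new demands although \<open>g\<close> or \<open>h\<close>
    still satisfies it.\<close>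
  have D_cases: "(snd P = f b (fst P) \<and> fst P \<in> {m..M} \<and> snd P \<in> {m..M}) \<or>
      (\<exists>i<length w. fst (w ! i) = b \<and> t \<le> Suc i \<and> P = E i)" if PD: "P \<in> D b" for P b
  proof -
    consider a where "a \<in> A" "a \<in> {0<..<1}" "P = (a, f b a)"
      | i where "i < length w" "fst (w ! i) = b" "P = E i"
      using PD unfolding D_def by blast
    then show ?thesis
    proof cases
      case (1 a)
      then show ?thesis
        using data[of a] by (simp add: f_def)
    next
      case (2 i)
      show ?thesis
      proof (cases "t \<le> Suc i")
        case True
        then show ?thesis
          using 2 by blast
      next
        case False
        then have "y i \<in> {m..M}" "y (Suc i) \<in> {m..M}"
          using before[of i] before[of "Suc i"] y_eq[of i] y_eq[of "Suc i"] by auto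
        then have "fst (E i) \<in> {m..M} \<and> snd (E i) \<in> {m..M}"
          by (simp add: E_def)
        moreover have "snd (E i) = f b (fst (E i))"
          using old[of i] 2(2) False by simp
        ultimately show ?thesis
          using 2(3) by simp
      qed
    qed
  qed
  \<comment> \<open>Against old data, that transitional letter is compared by monotonicity of
    \<open>f b\<close>; only later letters need \<open>new_old\<close>.\<close>
  have on_graph_or_new: "snd (E i) = f (fst (w ! i)) (fst (E i)) \<or> t \<le> i" for i
    using old[of i] by linarith
  have comparable: "P = Q \<or> lt P Q \<or> lt Q P" if "P \<in> D b" "Q \<in> D b" for P Q b
    using D_cases[OF that(1)] D_cases[OF that(2)]
  proof (elim disjE exE conjE)
    fix i assume "fst (w ! i) = b" "P = E i"
      "snd Q = f b (fst Q)" "fst Q \<in> {m..M}" "snd Q \<in> {m..M}"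
    then show ?thesis
      using on_graph_or_new[of i] graph[of P b Q] new_old[of i Q] by blast
  next
    fix i assume "fst (w ! i) = b" "Q = E i"
      "snd P = f b (fst P)" "fst P \<in> {m..M}" "snd P \<in> {m..M}"
    then show ?thesis
      using on_graph_or_new[of i] graph[of P b Q] new_old[of i P] by blast
  next
    fix i j assume "i < length w" "fst (w ! i) = b" "t \<le> Suc i" "P = E i"
      "j < length w" "fst (w ! j) = b" "t \<le> Suc j" "Q = E j"
    then show ?thesis
      using new_new[of i j] new_new[of j i] by (cases i j rule: linorder_cases) auto
  qed (rule graph)
  have "\<exists>F\<in>Homeo_plus. \<forall>(a, a')\<in>D b. F a = a'" for b
  proof (rule Homeo_plus_extension)
    show "finite (D b)"
      using assms(3) by (simp add: D_def)
    have "f b a \<in> {0<..<1}" if "a \<in> {0<..<1}" for a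
      using Homeo_plus_interior[OF f] that by blast
    then show "D b \<subseteq> {0<..<1} \<times> {0<..<1}"
      using y_in by (auto simp: D_def E_def)
    show "fst P < fst Q \<longleftrightarrow> snd P < snd Q" if "P \<in> D b" "Q \<in> D b" for P Q
      using comparable[OF that] \<sigma> by (auto simp: lt_def)
  qed
  then have "\<forall>b. \<exists>F. F \<in> Homeo_plus \<and> (\<forall>(a, a')\<in>D b. F a = a')"
    by blast
  from choice[OF this] obtain F where "\<forall>b. F b \<in> Homeo_plus \<and> (\<forall>(a, a')\<in>D b. F b a = a')"
    by (elim exE)
  then have F: "\<And>b. F b \<in> Homeo_plus" "\<And>b a a'. (a, a') \<in> D b \<Longrightarrow> F b a = a'"
    by auto
  have step: "letter_map (F True, F False) (w ! i) (y i) = y (Suc i)" if "i < length w" for i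
  proof -
    obtain b e where be: "w ! i = (b, e)"
      by fastforce
    have "E i \<in> D b"
      using that be by (auto simp: D_def)
    then have "if e then F b (y i) = y (Suc i) else F b (y (Suc i)) = y i"
      using F(2) be by (auto simp: E_def)
    then show ?thesis
      using Homeo_plus_inverse(2)[OF F(1)[of b], of "y (Suc i)"]
      by (cases b; cases e) (auto simp: be)
  qed
  have path: "word_map (F True, F False) (take i w) c = y i" if "i \<le> length w" for i
    using that
  proof (induction i)
    case 0
    then show ?case
      using y_eq[of 0] by (simp add: x_def)
  next
    case (Suc i)
    then show ?case
      using step[of i] by (simp add: take_Suc_conv_app_nth word_map_append)
  qed
  have "word_map (F True, F False) w c \<notin> {m..M}"
    using path[of "length w"] y_out[OF t, of "y (length w)"] by auto
  moreover have "F True a = g a \<and> F False a = h a" if "a \<in> A" for a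
  proof (cases "a \<in> {0<..<1}")
    case True
    then have "(a, f b a) \<in> D b" for b
      using that by (simp add: D_def)
    then show ?thesis
      using F(2) unfolding f_def by (metis (full_types))
  next
    case False
    then show ?thesis
      using F(1) g h by (simp add: Homeo_plus_fixed_outside)
  qed
  ultimately show ?thesis
    using F(1) by blast
qed

text \<open>\<open>V\<close> constrains the pair only near its values on \<open>A\<close>, so the
  pair may be changed elsewhere. A word \<open>q\<close> occurring in \<open>W j\<close> forces the
  exit from \<open>[m, M]\<close> at which the change begins.\<close>

lemma dense_escaping:
  assumes V: "openin (prod_topology H_top H_top) V" "V \<noteq> {}"
    and red: "\<forall>j. reduced_word (W j)"
    and sup: "\<forall>j q. reduced_word q \<longrightarrow> length q \<le> j \<longrightarrow> (\<exists>y z. W j = y @ q @ z)"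
  shows "\<exists>p\<in>V. \<exists>j\<ge>N. word_map p (W j) (1/2) \<notin> {1/4..3/4}"
proof -
  obtain g0 h0 where V0: "(g0, h0) \<in> V"
    using V(2) by auto
  then have H0: "g0 \<in> Homeo_plus" "h0 \<in> Homeo_plus"
    using openin_subset[OF V(1)] by auto
  obtain A \<epsilon> where A: "finite A" "A \<subseteq> {0..1}" "0 < \<epsilon>"
    "\<forall>g'\<in>Homeo_plus. \<forall>h'\<in>Homeo_plus.
       (\<forall>a\<in>A. \<bar>g' a - g0 a\<bar> < \<epsilon> \<and> \<bar>h' a - h0 a\<bar> < \<epsilon>) \<longrightarrow> (g', h') \<in> V"
    by (rule openin_prod_H_top_nbhd[OF V(1) V0]) (rule that)
  obtain g h \<delta> where g: "g \<in> Homeo_plus" and h: "h \<in> Homeo_plus" and "0 < (\<delta>::real)"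
    and "\<And>x. x \<le> \<delta> \<Longrightarrow> g x = x"
    and no_fix: "\<And>x. x \<in> {0<..<1} \<Longrightarrow> g x \<noteq> x \<or> h x \<noteq> x"
    and near: "\<And>a. a \<in> A \<Longrightarrow> \<bar>g a - g0 a\<bar> < \<epsilon>" "\<And>a. a \<in> A \<Longrightarrow> \<bar>h a - h0 a\<bar> < \<epsilon>"
    by (rule dense_no_common_fixed_point[OF H0 A(1,3)]) (rule that)
  have p: "(g, h) \<in> Homeo_plus \<times> Homeo_plus"
    using g h by simp
  define B where "B = A \<inter> {0<..<1}"
  \<comment> \<open>Including 1/4 and 3/4 makes \<open>[m, M]\<close> contain
    \<open>[1/4, 3/4]\<close>, so that a point outside the former is outside the latter.\<close>
  define C where "C = {1/4, 3/4} \<union> B \<union> g ` B \<union> h ` B"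
  have C: "finite C" "C \<noteq> {}"
    using A(1) by (auto simp: C_def B_def)
  have C_in: "C \<subseteq> {0<..<1}"
  proof -
    have "B \<subseteq> {0<..<1}"
      by (simp add: B_def)
    moreover from this have "g ` B \<subseteq> {0<..<1}" "h ` B \<subseteq> {0<..<1}"
      using Homeo_plus_interior[OF g] Homeo_plus_interior[OF h] by blast+
    ultimately show ?thesis
      unfolding C_def by (intro Un_least) simp_all
  qed
  define m M where "m = Min C" and "M = Max C"
  have mM: "m \<in> {0<..<1}" "M \<in> {0<..<1}"
    using C_in Min_in[OF C] Max_in[OF C] unfolding m_def M_def by blast+
  have bounds: "a \<in> {m..M}" if "a \<in> C" for a
    using C(1) that by (simp add: m_def M_def)
  have quarter: "m \<le> 1/4" "3/4 \<le> M"
    using bounds[of "1/4"] bounds[of "3/4"] by (simp_all add: C_def)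
  obtain q where q: "reduced_word q" "word_map (g, h) q M < m"
    using exists_word_below[OF g h no_fix _ mM(2), of m] mM(1) by auto
  define j where "j = max N (length q)"
  obtain y z where W: "W j = y @ q @ z"
    using sup[rule_format, OF q(1), of j] by (auto simp: j_def)
  \<comment> \<open>Either the prefix \<open>y\<close> has already left \<open>[m, M]\<close>, or it
    yields a point at most \<open>M\<close>, which \<open>q\<close> sends below
    \<open>m\<close>.\<close>
  have "\<exists>s\<le>length (W j). word_map (g, h) (take s (W j)) (1/2) \<notin> {m..M}"
  proof (cases "word_map (g, h) y (1/2) \<in> {m..M}")
    case True
    then have "word_map (g, h) q (word_map (g, h) y (1/2)) \<le> word_map (g, h) q M"
      using Homeo_plus_less_iff[OF word_map_in_Homeo_plus[OF p], of q M "word_map (g, h) y (1/2)"]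
      by (auto simp: not_less[symmetric])
    then show ?thesis
      using q(2) by (intro exI[of _ "length (y @ q)"]) (simp add: W word_map_append)
  next
    case False
    then show ?thesis
      by (intro exI[of _ "length y"]) (simp add: W)
  qed
  then obtain s where s: "s \<le> length (W j)" "word_map (g, h) (take s (W j)) (1/2) \<notin> {m..M}"
    by blast
  have data: "a \<in> {m..M} \<and> g a \<in> {m..M} \<and> h a \<in> {m..M}" if "a \<in> A" "a \<in> {0<..<1}" for a
    using that by (intro conjI bounds) (auto simp: C_def B_def)
  have half: "1/2 \<in> {m..M}"
    using quarter by simp
  obtain g' h' where g': "g' \<in> Homeo_plus" and h': "h' \<in> Homeo_plus"
    and agree: "\<forall>a\<in>A. g' a = g a \<and> h' a = h a" and out: "word_map (g', h') (W j) (1/2) \<notin> {m..M}"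
    using exists_escaping_pair[OF g h A(1) red[rule_format] _ _ data half s] mM by auto
  have "(g', h') \<in> V"
    using A(4) g' h' agree near by simp
  moreover have "word_map (g', h') (W j) (1/2) \<notin> {1/4..3/4}"
    using out quarter by auto
  moreover have "N \<le> j"
    by (simp add: j_def)
  ultimately show ?thesis
    by blast
qed

section \<open>Similarity classes\<close>

lemma word_map_hom:
  assumes p: "p \<in> Homeo_plus \<times> Homeo_plus" and q: "q \<in> Homeo_plus \<times> Homeo_plus"
    and hom: "\<phi> \<in> hom (subgroup_generated H_group {fst p, snd p}) (subgroup_generated H_group {fst q, snd q})"
    and \<phi>: "\<phi> (fst p) = fst q" "\<phi> (snd p) = snd q"
  shows "word_map p w \<in> carrier (subgroup_generated H_group {fst p, snd p})"
    and "\<phi> (word_map p w) = word_map q w"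
proof -
  interpret H: group H_group
    by (rule group_H_group)
  let ?G = "subgroup_generated H_group {fst p, snd p}"
  let ?K = "subgroup_generated H_group {fst q, snd q}"
  interpret G: group ?G by simp
  interpret K: group ?K by simp
  interpret \<phi>: group_hom ?G ?K \<phi>
    by unfold_locales (rule hom)
  have carrier: "carrier H_group = Homeo_plus" and mult: "mult H_group = (\<circ>)" and one: "\<one>\<^bsub>H_group\<^esub> = id"
    by (auto simp: H_group_def)
  have gen: "x \<in> carrier (subgroup_generated H_group {fst r, snd r})"
    if "r \<in> Homeo_plus \<times> Homeo_plus" "x \<in> {fst r, snd r}" for x r
    unfolding carrier_subgroup_generated using that by (intro generate.incl) (auto simp: carrier)
  \<comment> \<open>Inverses in the generated subgroup are inverse functions, the form in which
    \<open>letter_map\<close> uses them.\<close>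
  have inv_eq: "inv\<^bsub>subgroup_generated H_group S\<^esub> x = inv_into UNIV x"
    if "x \<in> carrier (subgroup_generated H_group S)" for x S
    using H.inv_subgroup_generated[OF that] H.carrier_subgroup_generated_subset[of S] that
    by (auto simp: inv_H_group carrier)
  have letter: "letter_map p s \<in> carrier ?G \<and> \<phi> (letter_map p s) = letter_map q s" for s
  proof -
    obtain b e where s: "s = (b, e)"
      by fastforce
    define x where "x = (if b then fst p else snd p)"
    define y where "y = (if b then fst q else snd q)"
    have x: "x \<in> carrier ?G" and y: "y \<in> carrier ?K" and xy: "\<phi> x = y"
      using gen[OF p, of x] gen[OF q, of y] \<phi> by (auto simp: x_def y_def)
    have "inv_into UNIV x \<in> carrier ?G"
      using G.inv_closed[OF x] inv_eq[OF x] by simp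
    moreover have "\<phi> (inv_into UNIV x) = inv_into UNIV y"
      using \<phi>.hom_inv[OF x] inv_eq[OF x] inv_eq[OF y] xy by simp
    ultimately show ?thesis
      using x xy by (auto simp: s Let_def x_def[symmetric] y_def[symmetric])
  qed
  have "word_map p w \<in> carrier ?G \<and> \<phi> (word_map p w) = word_map q w"
  proof (induction w)
    case Nil
    then show ?case
      using G.one_closed \<phi>.hom_one by (simp only: word_map.simps one one_subgroup_generated)
  next
    case (Cons s w)
    have w: "word_map p w \<in> carrier ?G" and s: "letter_map p s \<in> carrier ?G"
      using Cons letter by auto
    show ?case
      using G.m_closed[OF w s] \<phi>.hom_mult[OF w s] Cons letter[of s]
      by (simp only: word_map.simps mult mult_subgroup_generated)
  qed
  then show "word_map p w \<in> carrier ?G" "\<phi> (word_map p w) = word_map q w"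
    by auto
qed

text \<open>Topological similarity enters only through these two claims: continuity of
  \<open>\<phi>\<close> at the identity gives the first, openness of \<open>\<phi>\<close> the
  second. The bound \<open>N\<close> may depend on \<open>p\<close>, which is why the class is later
  covered by a union over \<open>N\<close>.\<close>

lemma top_similar_word_map:
  assumes p: "p \<in> Homeo_plus \<times> Homeo_plus" and q: "q \<in> Homeo_plus \<times> Homeo_plus"
    and sim: "top_similar H_group H_top p q" and U: "openin H_top U" "id \<in> U"
  shows "\<exists>N. \<forall>k\<ge>N. \<forall>w. word_map p w \<in> id_nbhd k \<longrightarrow> word_map q w \<in> U"
    and "\<exists>N. \<forall>k\<ge>N. \<forall>w. word_map q w \<in> id_nbhd k \<longrightarrow> word_map p w \<in> U"
proof -
  define G where "G = carrier (subgroup_generated H_group {fst p, snd p})"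
  define K where "K = carrier (subgroup_generated H_group {fst q, snd q})"
  obtain \<phi> where iso: "\<phi> \<in> iso (subgroup_generated H_group {fst p, snd p}) (subgroup_generated H_group {fst q, snd q})"
    and gens: "\<phi> (fst p) = fst q" "\<phi> (snd p) = snd q"
    and homeo: "homeomorphic_map (subtopology H_top G) (subtopology H_top K) \<phi>"
    using sim unfolding top_similar_def G_def K_def by blast
  have hom: "\<phi> \<in> hom (subgroup_generated H_group {fst p, snd p}) (subgroup_generated H_group {fst q, snd q})"
    and bij: "bij_betw \<phi> G K"
    using iso by (auto simp: iso_def G_def K_def)
  have wG: "word_map p w \<in> G" and w\<phi>: "\<phi> (word_map p w) = word_map q w" for w
    using word_map_hom[OF p q hom gens] by (auto simp: G_def)
  have wK: "word_map q w \<in> K" for w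
    using bij_betw_apply[OF bij wG[of w]] by (simp only: w\<phi>)
  have id_mem: "id \<in> G" "\<phi> id = id" "id \<in> K"
    using wG[of "[]"] w\<phi>[of "[]"] wK[of "[]"] by (simp_all only: word_map.simps)
  have sub: "G \<subseteq> Homeo_plus"
    using group.carrier_subgroup_generated_subset[OF group_H_group] by (auto simp: G_def H_group_def)
  show "\<exists>N. \<forall>k\<ge>N. \<forall>w. word_map p w \<in> id_nbhd k \<longrightarrow> word_map q w \<in> U"
  proof -
    have "continuous_map (subtopology H_top G) (subtopology H_top K) \<phi>"
      using homeo by (rule homeomorphic_imp_continuous_map)
    moreover have "openin (subtopology H_top K) (U \<inter> K)"
      using U(1) by (auto simp: openin_subtopology)
    ultimately have "openin (subtopology H_top G) {x \<in> topspace (subtopology H_top G). \<phi> x \<in> U \<inter> K}"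
      by (rule openin_continuous_map_preimage)
    then obtain T where T: "openin H_top T" "{x \<in> G. \<phi> x \<in> U \<inter> K} = T \<inter> G"
      using sub by (auto simp: openin_subtopology Int_absorb1)
    have "id \<in> T"
    proof -
      have "id \<in> {x \<in> G. \<phi> x \<in> U \<inter> K}"
        using id_mem U(2) by simp
      then show ?thesis
        unfolding T(2) by simp
    qed
    then obtain N where N: "\<And>k. k \<ge> N \<Longrightarrow> id_nbhd k \<subseteq> T"
      using id_nbhd_subset[OF T(1)] by blast
    have "word_map q w \<in> U" if "N \<le> k" "word_map p w \<in> id_nbhd k" for k w
    proof -
      have "word_map p w \<in> {x \<in> G. \<phi> x \<in> U \<inter> K}"
        unfolding T(2) using N[OF that(1)] that(2) wG by blast
      then show ?thesis
        by (simp add: w\<phi>)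
    qed
    then show ?thesis
      by blast
  qed
  show "\<exists>N. \<forall>k\<ge>N. \<forall>w. word_map q w \<in> id_nbhd k \<longrightarrow> word_map p w \<in> U"
  proof -
    have "open_map (subtopology H_top G) (subtopology H_top K) \<phi>"
      using homeo by (rule homeomorphic_imp_open_map)
    moreover have "openin (subtopology H_top G) (U \<inter> G)"
      using U(1) by (auto simp: openin_subtopology)
    ultimately have "openin (subtopology H_top K) (\<phi> ` (U \<inter> G))"
      by (simp add: open_map_def)
    then obtain T where T: "openin H_top T" "\<phi> ` (U \<inter> G) = T \<inter> K"
      by (auto simp: openin_subtopology)
    have "\<phi> id \<in> \<phi> ` (U \<inter> G)"
      using id_mem U(2) by blast
    then have "id \<in> T"
      unfolding T(2) id_mem(2) by simp
    then obtain N where N: "\<And>k. k \<ge> N \<Longrightarrow> id_nbhd k \<subseteq> T"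
      using id_nbhd_subset[OF T(1)] by blast
    have "word_map p w \<in> U" if "N \<le> k" "word_map q w \<in> id_nbhd k" for k w
    proof -
      have "word_map q w \<in> \<phi> ` (U \<inter> G)"
        unfolding T(2) using N[OF that(1)] that(2) wK by blast
      then obtain x where x: "x \<in> U" "x \<in> G" "\<phi> x = word_map q w"
        by auto
      have "x = word_map p w"
        by (rule inj_onD[OF bij_betw_imp_inj_on[OF bij]]) (simp_all add: x wG w\<phi>)
      then show ?thesis
        using x(1) by simp
    qed
    then show ?thesis
      by blast
  qed
qed

section \<open>The nowhere dense sets that cover a similarity class\<close>

lemma id_in_id_nbhd: "id \<in> id_nbhd n"
  by (simp add: id_nbhd_def id_in_Homeo_plus)

lemma openin_id_nbhd: "openin H_top (id_nbhd n)"
proof -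
  have "openin H_top {f \<in> topspace H_top. f \<in> id_nbhd n}"
    by (rule openin_Collect_id_nbhd) (simp_all add: continuous_map_eval)
  moreover have "{f \<in> topspace H_top. f \<in> id_nbhd n} = id_nbhd n"
    by (auto simp: id_nbhd_def)
  ultimately show ?thesis
    by simp
qed

text \<open>These pairs freely generate a group whose discreteness is witnessed by
  \<open>id_nbhd n\<close>. The set is closed because each word contributes an open condition to the
  complement, which is dense by \<open>dense_near_id\<close>.\<close>

lemma nowhere_dense_discrete_free:
  "nowhere_dense_in (prod_topology H_top H_top)
     {p \<in> Homeo_plus \<times> Homeo_plus. \<forall>w. w \<noteq> [] \<longrightarrow> reduced_word w \<longrightarrow> word_map p w \<notin> id_nbhd n}"
proof (rule nowhere_dense_inI)
  let ?T = "prod_topology H_top H_top"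
  let ?O = "\<lambda>w. {p \<in> topspace ?T. word_map p w \<in> id_nbhd n}"
  have "openin ?T (\<Union>w\<in>{w. w \<noteq> [] \<and> reduced_word w}. ?O w)"
    by (intro openin_Union ballI, clarify)
      (rule openin_Collect_id_nbhd, simp_all add: word_map_in_Homeo_plus continuous_map_word_map)
  then have "closedin ?T (topspace ?T - (\<Union>w\<in>{w. w \<noteq> [] \<and> reduced_word w}. ?O w))"
    by (rule closedin_diff[OF closedin_topspace])
  moreover have "topspace ?T - (\<Union>w\<in>{w. w \<noteq> [] \<and> reduced_word w}. ?O w) =
      {p \<in> Homeo_plus \<times> Homeo_plus. \<forall>w. w \<noteq> [] \<longrightarrow> reduced_word w \<longrightarrow> word_map p w \<notin> id_nbhd n}"
    by auto
  ultimately show "closedin ?T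
      {p \<in> Homeo_plus \<times> Homeo_plus. \<forall>w. w \<noteq> [] \<longrightarrow> reduced_word w \<longrightarrow> word_map p w \<notin> id_nbhd n}"
    by simp
next
  fix V assume "openin (prod_topology H_top H_top) V" "V \<noteq> {}"
  then show "\<exists>p\<in>V. p \<notin> {p \<in> Homeo_plus \<times> Homeo_plus.
      \<forall>w. w \<noteq> [] \<longrightarrow> reduced_word w \<longrightarrow> word_map p w \<notin> id_nbhd n}"
    using dense_near_id[of V n] by blast
qed

text \<open>The closed interval makes the set closed, and \<open>dense_escaping\<close> makes its
  complement dense.\<close>

lemma nowhere_dense_not_escaping:
  assumes "\<forall>j. reduced_word (W j)"
    and "\<forall>j q. reduced_word q \<longrightarrow> length q \<le> j \<longrightarrow> (\<exists>y z. W j = y @ q @ z)"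
  shows "nowhere_dense_in (prod_topology H_top H_top)
     {p \<in> Homeo_plus \<times> Homeo_plus. \<forall>j\<ge>N. word_map p (W j) (1/2) \<in> {1/4..3/4}}"
proof (rule nowhere_dense_inI)
  let ?T = "prod_topology H_top H_top"
  have "closedin ?T {p \<in> topspace ?T. word_map p (W j) (1/2) \<in> {1/4..3/4}}" for j
    using continuous_map_word_map by (rule closedin_continuous_map_preimage) simp
  then have "closedin ?T (\<Inter>j\<in>{N..}. {p \<in> topspace ?T. word_map p (W j) (1/2) \<in> {1/4..3/4}})"
    by (intro closedin_INT) auto
  moreover have "(\<Inter>j\<in>{N..}. {p \<in> topspace ?T. word_map p (W j) (1/2) \<in> {1/4..3/4}}) =
      {p \<in> Homeo_plus \<times> Homeo_plus. \<forall>j\<ge>N. word_map p (W j) (1/2) \<in> {1/4..3/4}}"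
    by auto
  ultimately show "closedin ?T
      {p \<in> Homeo_plus \<times> Homeo_plus. \<forall>j\<ge>N. word_map p (W j) (1/2) \<in> {1/4..3/4}}"
    by simp
next
  fix V assume "openin (prod_topology H_top H_top) V" "V \<noteq> {}"
  from dense_escaping[where N = N, OF this assms]
  obtain p j where "p \<in> V" "N \<le> j" "word_map p (W j) (1/2) \<notin> {1/4..3/4}"
    by blast
  then show "\<exists>p\<in>V. p \<notin> {p \<in> Homeo_plus \<times> Homeo_plus. \<forall>j\<ge>N. word_map p (W j) (1/2) \<in> {1/4..3/4}}"
    by (intro bexI[of _ p]) auto
qed

text \<open>A word \<open>w\<close> close to the identity is conjugated by a universal word
  \<open>u\<close>; continuity of conjugation keeps the result close. A letter \<open>l\<close>
  placed between them prevents cancellation.\<close>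

lemma exists_universal_word_near_id:
  assumes f: "f \<in> Homeo_plus \<times> Homeo_plus"
    and small: "\<And>n. \<exists>w. w \<noteq> [] \<and> reduced_word w \<and> word_map f w \<in> id_nbhd n"
  shows "\<exists>v. reduced_word v \<and> (\<forall>q. reduced_word q \<longrightarrow> length q \<le> j \<longrightarrow> (\<exists>y z. v = y @ q @ z))
           \<and> word_map f v \<in> id_nbhd j"
proof -
  define Q :: "(bool \<times> bool) list set" where "Q = {q. reduced_word q \<and> length q \<le> j}"
  have "finite Q"
    by (rule finite_subset[OF _ finite_lists_length_le[of UNIV j]]) (auto simp: Q_def)
  then have "\<exists>u. reduced_word u \<and> (\<forall>q\<in>Q. \<exists>y z. u = y @ q @ z)"
    by (rule exists_reduced_superword) (simp add: Q_def)
  then obtain u where u: "reduced_word u" "\<forall>q\<in>Q. \<exists>y z. u = y @ q @ z"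
    by blast
  define conj where "conj l x = word_map f (word_inv (u @ [l])) \<circ> x \<circ> word_map f (u @ [l])" for l and x :: "real \<Rightarrow> real"
  \<comment> \<open>The letter \<open>l\<close> can be chosen only after \<open>w\<close>, so the
    neighbourhood has to serve all four letters at once.\<close>
  define U where "U = (\<Inter>l. {x \<in> topspace H_top. conj l x \<in> id_nbhd j})"
  have "openin H_top {x \<in> topspace H_top. conj l x \<in> id_nbhd j}" for l
  proof (rule openin_Collect_id_nbhd)
    show "conj l x \<in> Homeo_plus" if "x \<in> topspace H_top" for x
      using that word_map_in_Homeo_plus[OF f] by (auto simp: conj_def intro!: Homeo_plus_comp)
    show "continuous_map H_top euclideanreal (\<lambda>x. conj l x y)" for y
      using continuous_map_apply[of H_top "\<lambda>_. word_map f (word_inv (u @ [l]))", OF _ continuous_map_eval]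
        word_map_in_Homeo_plus[OF f]
      by (simp add: conj_def)
  qed
  then have U: "openin H_top U"
    unfolding U_def by (intro openin_INT2) auto
  have "conj l id = id" for l
    using word_map_word_inv[OF f, of "u @ [l]"] by (simp add: conj_def fun_eq_iff)
  then have "id \<in> U"
    by (simp add: U_def id_in_Homeo_plus id_in_id_nbhd)
  then obtain N where N: "id_nbhd N \<subseteq> U"
    using id_nbhd_subset[OF U] by blast
  obtain w where w: "w \<noteq> []" "reduced_word w" "word_map f w \<in> id_nbhd N"
    using small by blast
  \<comment> \<open>In this order, the conditions keep reduced: \<open>[l] @ w\<close>, then
    \<open>w @ [letter_inv l]\<close>, then both junctions with \<open>u\<close> and
    \<open>word_inv u\<close>.\<close>
  obtain l where l: "l \<noteq> letter_inv (hd w)" "l \<noteq> last w" "l \<noteq> letter_inv (last u)"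
    by (rule exists_letter_avoiding)
  define v where "v = u @ [l] @ w @ [letter_inv l] @ word_inv u"
  have inv_Nil: "word_inv u = [] \<longleftrightarrow> u = []"
    by (simp add: word_inv_def)
  have hd_inv: "hd (word_inv u) = letter_inv (last u)" if "u \<noteq> []"
    using that by (simp add: word_inv_def hd_rev last_map)
  have single: "reduced_word [s]" for s
    by (simp add: reduced_word_def)
  have "reduced_word v"
    unfolding v_def using u(1) w(1,2) l hd_inv
    by (auto simp: reduced_word_append reduced_word_Cons inv_Nil single)
  moreover have "\<exists>y z. v = y @ q @ z" if "reduced_word q" "length q \<le> j" for q
  proof -
    have "q \<in> Q"
      using that by (simp add: Q_def)
    then obtain y z where "u = y @ q @ z"
      using u(2) by blast
    then have "v = y @ q @ (z @ [l] @ w @ [letter_inv l] @ word_inv u)"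
      by (simp add: v_def)
    then show ?thesis
      by blast
  qed
  moreover have "word_map f v = conj l (word_map f w)"
    by (simp add: v_def conj_def word_map_append word_inv_def comp_assoc)
  then have "word_map f v \<in> id_nbhd j"
    using w(3) N by (auto simp: U_def)
  ultimately show ?thesis
    by blast
qed

theorem theorem3p14:
  assumes "f1 \<in> Homeo_plus" and "f2 \<in> Homeo_plus"
  shows "meager_in (prod_topology H_top H_top)
           {p \<in> Homeo_plus \<times> Homeo_plus. top_similar H_group H_top p (f1, f2)}"
proof (cases "\<exists>n. \<forall>w. w \<noteq> [] \<longrightarrow> reduced_word w \<longrightarrow> word_map (f1, f2) w \<notin> id_nbhd n")
  case True
  then obtain n where n: "\<And>w. w \<noteq> [] \<Longrightarrow> reduced_word w \<Longrightarrow> word_map (f1, f2) w \<notin> id_nbhd n"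
    by blast
  define S where "S k = {p \<in> Homeo_plus \<times> Homeo_plus.
      \<forall>w. w \<noteq> [] \<longrightarrow> reduced_word w \<longrightarrow> word_map p w \<notin> id_nbhd k}" for k
  have "\<exists>k. p \<in> S k" if p: "p \<in> Homeo_plus \<times> Homeo_plus" "top_similar H_group H_top p (f1, f2)" for p
  proof -
    \<comment> \<open>A nonempty reduced word in \<open>id_nbhd N\<close> at \<open>p\<close> would
      lie in \<open>id_nbhd n\<close> at \<open>(f1, f2)\<close>, against the choice of
      \<open>n\<close>.\<close>
    obtain N where "\<forall>k\<ge>N. \<forall>w. word_map p w \<in> id_nbhd k \<longrightarrow> word_map (f1, f2) w \<in> id_nbhd n"
      using top_similar_word_map(1)[OF p(1) _ p(2) openin_id_nbhd id_in_id_nbhd] assms by blast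
    then have "p \<in> S N"
      using n p(1) by (auto simp: S_def)
    then show ?thesis
      by blast
  qed
  then have "{p \<in> Homeo_plus \<times> Homeo_plus. top_similar H_group H_top p (f1, f2)} \<subseteq> \<Union> (range S)"
    by blast
  moreover have "\<forall>N\<in>range S. nowhere_dense_in (prod_topology H_top H_top) N"
    using nowhere_dense_discrete_free by (auto simp: S_def)
  ultimately show ?thesis
    unfolding meager_in_def by (intro exI[of _ "range S"]) simp
next
  case False
  have f: "(f1, f2) \<in> Homeo_plus \<times> Homeo_plus"
    using assms by simp
  have "\<exists>w. w \<noteq> [] \<and> reduced_word w \<and> word_map (f1, f2) w \<in> id_nbhd n" for n
    using False by blast
  then have "\<forall>j. \<exists>v. reduced_word v \<and> (\<forall>q. reduced_word q \<longrightarrow> length q \<le> j \<longrightarrow> (\<exists>y z. v = y @ q @ z))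
      \<and> word_map (f1, f2) v \<in> id_nbhd j"
    by (intro allI exists_universal_word_near_id[OF f])
  from choice[OF this] obtain W where "\<forall>j. reduced_word (W j) \<and>
      (\<forall>q. reduced_word q \<longrightarrow> length q \<le> j \<longrightarrow> (\<exists>y z. W j = y @ q @ z)) \<and>
      word_map (f1, f2) (W j) \<in> id_nbhd j"
    by (elim exE)
  then have W: "\<forall>j. reduced_word (W j)"
    "\<forall>j q. reduced_word q \<longrightarrow> length q \<le> j \<longrightarrow> (\<exists>y z. W j = y @ q @ z)"
    "\<forall>j. word_map (f1, f2) (W j) \<in> id_nbhd j"
    by simp_all
  define S where "S k = {p \<in> Homeo_plus \<times> Homeo_plus.
      \<forall>j\<ge>k. word_map p (W j) (1/2) \<in> {1/4..3/4}}" for k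
  \<comment> \<open>An open window inside the closed one of \<open>S\<close>: openness serves the
    transfer by similarity, closedness the nowhere density.\<close>
  define U where "U = {f \<in> topspace H_top. f (1/2) \<in> {1/4<..<3/4}}"
  have U: "openin H_top U" "id \<in> U"
    unfolding U_def by (rule openin_continuous_map_preimage[OF continuous_map_eval])
      (simp_all add: id_in_Homeo_plus)
  have "\<exists>k. p \<in> S k" if p: "p \<in> Homeo_plus \<times> Homeo_plus" "top_similar H_group H_top p (f1, f2)" for p
  proof -
    \<comment> \<open>Here the transfer runs from \<open>(f1, f2)\<close> to \<open>p\<close>: since
      \<open>W j\<close> tends to the identity at the former, it eventually lies in \<open>U\<close>
      at the latter.\<close>
    obtain N where N: "\<forall>k\<ge>N. \<forall>w. word_map (f1, f2) w \<in> id_nbhd k \<longrightarrow> word_map p w \<in> U"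
      using top_similar_word_map(2)[OF p(1) f p(2) U] by blast
    have "word_map p (W j) (1/2) \<in> {1/4..3/4}" if "N \<le> j" for j
    proof -
      have "word_map p (W j) \<in> U"
        using N W(3) that by blast
      then show ?thesis
        by (simp add: U_def)
    qed
    then have "p \<in> S N"
      using p(1) by (simp add: S_def)
    then show ?thesis
      by blast
  qed
  then have "{p \<in> Homeo_plus \<times> Homeo_plus. top_similar H_group H_top p (f1, f2)} \<subseteq> \<Union> (range S)"
    by blast
  moreover have "\<forall>N\<in>range S. nowhere_dense_in (prod_topology H_top H_top) N"
    using nowhere_dense_not_escaping[OF W(1,2)] by (auto simp: S_def)
  ultimately show ?thesis
    unfolding meager_in_def by (intro exI[of _ "range S"]) simp
qed

end
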